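(* Assume the standing hypotheses H1, H2 (with Lipschitz constant $L>0$) and H3 listed in the context, and consider the fully-discrete $L2$-$1_\sigma$ finite element scheme on the graded mesh described there. There exist positive constants $C_1,C_2$, independent of $h$ and $N$, such that the following holds. Let $1\le n\le N$ and let $U^0,\dots,U^{n-1}\in V_h$ be given (with $U^1,\dots,U^{n-1}$ being solutions of the scheme at the time levels $1,\dots,n-1$). Put $$R_1=C_2\,(1+\|\nabla U^0\|),\qquad \tau:=\frac{2m_1\,(a_{n,n}+b_{n,n-1})}{(1-\sigma)\,\{L\,C_1\,R_1\,(1-2\sigma)\}^2}.$$ If $\max_{1\le m\le N}\tau_m\le\tau$, then there exists a unique $U^n\in V_h$ such that for all $v_h\in V_h$ $$(D^\alpha_NU^{n-\sigma},v_h)+a\big(l(U^{n,\sigma})\big)(\nabla U^{n,\sigma},\nabla v_h)=(f^{n-\sigma},v_h).$$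
   Context: **Setting.** $\Omega\subset\mathbb{R}^d$ ($d=1$ or $2$) is a bounded domain with smooth boundary, $T>0$, $\alpha\in(0,1)$, $l(w)=\int_\Omega w\,dx$. $(\cdot,\cdot)$ and $\|\cdot\|$ are the inner product and norm of $L^2(\Omega)$. **Standing hypotheses.** H1: there are $m_1,m_2>0$ with $0<m_1\le a(x)\le m_2<\infty$ for all $x\in\mathbb{R}$. H2: $|a(x_1)-a(x_2)|\le L|x_1-x_2|$ for all $x_1,x_2\in\mathbb{R}$. H3: $f\in L^2(0,T;L^2(\Omega))$ and $u_0\in H^1_0(\Omega)\cap H^2(\Omega)$. The values $f^{n-\sigma}:=f(\cdot,t_{n-\sigma})\in L^2(\Omega)$ used by the scheme are assumed to be defined. **Space discretization.** $\Omega$ is partitioned quasi-uniformly into intervals ($d=1$) or triangles ($d=2$) with mesh size $h$; $V_h\subset H^1_0(\Omega)$ is the finite-dimensional space of continuous piecewise linear functions on this partition. **Time discretization.** $N\in\mathbb{N}$, $r\ge1$, $t_n=T(n/N)^r$ for $0\le n\le N$, $\tau_n=t_n-t_{n-1}$, $\sigma=\alpha/2$, $t_{n-\sigma}=(1-\sigma)t_n+\sigma t_{n-1}$, $t_{j-1/2}=(t_{j-1}+t_j)/2$. For a sequence $(v^n)$ put $v^{n,\sigma}=(1-\sigma)v^n+\sigma v^{n-1}$. The $L2$-$1_\sigma$ operator is $$D^\alpha_Nv^{n-\sigma}=\sum_{j=1}^n g_{n,j}(v^j-v^{j-1}),$$ where $g_{1,1}=\tau_1^{-1}a_{1,1}$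 and for $n\ge2$: $g_{n,1}=\tau_1^{-1}(a_{n,1}-b_{n,1})$; $g_{n,j}=\tau_j^{-1}(a_{n,j}+b_{n,j-1}-b_{n,j})$ for $2\le j\le n-1$; $g_{n,n}=\tau_n^{-1}(a_{n,n}+b_{n,n-1})$; with $$a_{n,n}=\tfrac{1}{\Gamma(1-\alpha)}\int_{t_{n-1}}^{t_{n-\sigma}}(t_{n-\sigma}-\eta)^{-\alpha}d\eta,\qquad a_{n,j}=\tfrac{1}{\Gamma(1-\alpha)}\int_{t_{j-1}}^{t_j}(t_{n-\sigma}-\eta)^{-\alpha}d\eta\ (1\le j\le n-1),$$ $$b_{n,j}=\tfrac{2}{\Gamma(1-\alpha)(t_{j+1}-t_{j-1})}\int_{t_{j-1}}^{t_j}(t_{n-\sigma}-\eta)^{-\alpha}(\eta-t_{j-1/2})\,d\eta\ (1\le j\le n-1),$$ and the convention $b_{1,0}=0$, so that $g_{n,n}=\tau_n^{-1}(a_{n,n}+b_{n,n-1})$ for all $n\ge1$. **Fully-discrete scheme.** $U^0=u_h^0\in V_h$ is some approximation of $u_0$, and for each $n=1,\dots,N$ one seeks $U^n\in V_h$ satisfying the equation displayed in the claim for all $v_h\in V_h$. **Constants.** $C_1,C_2$ do not depend on $h$, $N$, $n$ or $U^0$, but may depend on the data $\alpha,T,\Omega,r,a$ and on $\max_{1\le j\le N}\|f^{j-\sigma}\|$. *)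

theory Defs
  imports "HOL-Analysis.Analysis"
begin

section \<open>Domains with smooth boundary\<close>

definition partial_deriv :: "'a::euclidean_space \<Rightarrow> ('a \<Rightarrow> real) \<Rightarrow> 'a \<Rightarrow> real" where
  "partial_deriv b u x = frechet_derivative u (at x) b"

text \<open>Only used for open \<open>S\<close>.\<close>

primrec Ck_on :: "nat \<Rightarrow> 'a::euclidean_space set \<Rightarrow> ('a \<Rightarrow> real) \<Rightarrow> bool" where
  "Ck_on 0 S u \<longleftrightarrow> continuous_on S u"
| "Ck_on (Suc k) S u \<longleftrightarrow>
     u differentiable_on S \<and> (\<forall>b\<in>Basis. Ck_on k S (partial_deriv b u))"

definition smooth_on :: "'a::euclidean_space set \<Rightarrow> ('a \<Rightarrow> real) \<Rightarrow> bool" where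
  "smooth_on S u \<longleftrightarrow> (\<forall>k. Ck_on k S u)"

definition grad :: "('a::euclidean_space \<Rightarrow> real) \<Rightarrow> 'a \<Rightarrow> 'a" where
  "grad u x = (THE D. GDERIV u x :> D)"

text \<open>Near each boundary point, \<open>\<Omega>\<close> is the negativity set of a smooth function whose gradient
  does not vanish there. In dimension 1 this holds for every bounded open interval.\<close>

definition smooth_boundary :: "'a::euclidean_space set \<Rightarrow> bool" where
  "smooth_boundary \<Omega> \<longleftrightarrow>
     (\<forall>p\<in>frontier \<Omega>. \<exists>S \<psi>. open S \<and> p \<in> S \<and> smooth_on S \<psi> \<and> grad \<psi> p \<noteq> 0 \<and>
        \<Omega> \<inter> S = {x \<in> S. \<psi> x < 0})"

definition smooth_bounded_domain :: "'a::euclidean_space set \<Rightarrow> bool" where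
  "smooth_bounded_domain \<Omega> \<longleftrightarrow>
     open \<Omega> \<and> connected \<Omega> \<and> \<Omega> \<noteq> {} \<and> bounded \<Omega> \<and> smooth_boundary \<Omega>"


section \<open>Function spaces\<close>

text \<open>Elements of \<open>L2\<close> and of the Sobolev spaces are represented by functions, not by classes
  modulo null sets. \<open>L2_inner\<close> and \<open>L2_norm\<close> are also used for vector fields (gradients); for
  real-valued functions the inner product of the values is multiplication.\<close>

definition L2 :: "'a::euclidean_space set \<Rightarrow> ('a \<Rightarrow> real) set" where
  "L2 \<Omega> = {u. u \<in> borel_measurable (lebesgue_on \<Omega>) \<and> integrable (lebesgue_on \<Omega>) (\<lambda>x. (u x)\<^sup>2)}"

definition L2_inner ::
    "'a::euclidean_space set \<Rightarrow> ('a \<Rightarrow> 'b::real_inner) \<Rightarrow> ('a \<Rightarrow> 'b) \<Rightarrow> real" where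
  "L2_inner \<Omega> u v = (LINT x|lebesgue_on \<Omega>. u x \<bullet> v x)"

definition L2_norm :: "'a::euclidean_space set \<Rightarrow> ('a \<Rightarrow> 'b::real_inner) \<Rightarrow> real" where
  "L2_norm \<Omega> u = sqrt (L2_inner \<Omega> u u)"

definition test_function :: "'a::euclidean_space set \<Rightarrow> ('a \<Rightarrow> real) \<Rightarrow> bool" where
  "test_function \<Omega> \<phi> \<longleftrightarrow> smooth_on UNIV \<phi> \<and>
     compact (closure {x. \<phi> x \<noteq> 0}) \<and> closure {x. \<phi> x \<noteq> 0} \<subseteq> \<Omega>"

definition weak_partial ::
    "'a::euclidean_space set \<Rightarrow> 'a \<Rightarrow> ('a \<Rightarrow> real) \<Rightarrow> ('a \<Rightarrow> real) \<Rightarrow> bool" where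
  "weak_partial \<Omega> b u g \<longleftrightarrow>
     (\<forall>\<phi>. test_function \<Omega> \<phi> \<longrightarrow>
        (LINT x|lebesgue_on \<Omega>. u x * partial_deriv b \<phi> x) = - (LINT x|lebesgue_on \<Omega>. g x * \<phi> x))"

primrec Sobolev_H :: "nat \<Rightarrow> 'a::euclidean_space set \<Rightarrow> ('a \<Rightarrow> real) set" where
  "Sobolev_H 0 \<Omega> = L2 \<Omega>"
| "Sobolev_H (Suc k) \<Omega> =
     {u \<in> L2 \<Omega>. \<forall>b\<in>Basis. \<exists>g\<in>Sobolev_H k \<Omega>. weak_partial \<Omega> b u g}"

text \<open>The closure of the test functions in the norm of \<open>H\<^sup>1\<close>.\<close>

definition Sobolev_H10 :: "'a::euclidean_space set \<Rightarrow> ('a \<Rightarrow> real) set" where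
  "Sobolev_H10 \<Omega> =
     {u \<in> Sobolev_H 1 \<Omega>. \<exists>\<phi> :: nat \<Rightarrow> 'a \<Rightarrow> real. (\<forall>k. test_function \<Omega> (\<phi> k)) \<and>
        (\<lambda>k. L2_norm \<Omega> (\<lambda>x. \<phi> k x - u x)) \<longlonglongrightarrow> 0 \<and>
        (\<forall>b\<in>Basis. \<exists>g\<in>L2 \<Omega>. weak_partial \<Omega> b u g \<and>
           (\<lambda>k. L2_norm \<Omega> (\<lambda>x. partial_deriv b (\<phi> k) x - g x)) \<longlonglongrightarrow> 0)}"

text \<open>The Bochner space \<open>L\<^sup>2(0,T;L\<^sup>2(\<Omega>))\<close>: strong measurability is approximability, almost
  everywhere in time, by measurable simple functions with values in \<open>L2 \<Omega>\<close>. The time variable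
  is the first argument of \<open>f\<close>.\<close>

definition simple_L2 :: "real \<Rightarrow> 'a::euclidean_space set \<Rightarrow> (real \<Rightarrow> 'a \<Rightarrow> real) \<Rightarrow> bool" where
  "simple_L2 T \<Omega> s \<longleftrightarrow>
     finite (s ` {0<..<T}) \<and> s ` {0<..<T} \<subseteq> L2 \<Omega> \<and>
     (\<forall>v. {t \<in> {0<..<T}. s t = v} \<in> sets lebesgue)"

definition Bochner_L2 :: "real \<Rightarrow> 'a::euclidean_space set \<Rightarrow> (real \<Rightarrow> 'a \<Rightarrow> real) set" where
  "Bochner_L2 T \<Omega> =
     {f. (AE t in lebesgue_on {0<..<T}. f t \<in> L2 \<Omega>) \<and>
         (\<exists>s :: nat \<Rightarrow> real \<Rightarrow> 'a \<Rightarrow> real. (\<forall>k. simple_L2 T \<Omega> (s k)) \<and>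
            (AE t in lebesgue_on {0<..<T}. (\<lambda>k. L2_norm \<Omega> (\<lambda>x. s k t x - f t x)) \<longlonglongrightarrow> 0)) \<and>
         integrable (lebesgue_on {0<..<T}) (\<lambda>t. (L2_norm \<Omega> (f t))\<^sup>2)}"


section \<open>Finite element space\<close>

definition mesh_size :: "'a::euclidean_space set set \<Rightarrow> real" where
  "mesh_size \<T> = Max (diameter ` \<T>)"

text \<open>A conforming mesh of \<open>\<Omega>\<close> by intervals (dimension 1) or triangles (dimension 2).
  In dimension 1 the mesh covers the closure of \<open>\<Omega>\<close>. A plane domain with smooth boundary is never
  a union of triangles, so there the mesh covers a polygon inside the closure of \<open>\<Omega>\<close>, up to a
  boundary layer no wider than the mesh size. The polygon must not stick out of \<open>\<Omega>\<close>, because the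
  finite element space has to be a subspace of \<open>H\<^sup>1\<^sub>0(\<Omega>)\<close>.\<close>

definition fe_mesh :: "'a::euclidean_space set \<Rightarrow> 'a set set \<Rightarrow> bool" where
  "fe_mesh \<Omega> \<T> \<longleftrightarrow>
     triangulation \<T> \<and> \<T> \<noteq> {} \<and> (\<forall>K\<in>\<T>. int DIM('a) simplex K) \<and>
     \<Union>\<T> \<subseteq> closure \<Omega> \<and>
     (DIM('a) = 1 \<longrightarrow> \<Union>\<T> = closure \<Omega>) \<and>
     (\<forall>x \<in> \<Omega> - \<Union>\<T>. infdist x (frontier \<Omega>) \<le> mesh_size \<T>)"

text \<open>Every element contains a ball of radius comparable to the global mesh size; this is shape
  regularity and quasi-uniformity in one condition.\<close>

definition quasi_uniform :: "real \<Rightarrow> 'a::euclidean_space set set \<Rightarrow> bool" where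
  "quasi_uniform \<kappa> \<T> \<longleftrightarrow> (\<forall>K\<in>\<T>. \<exists>x. cball x (\<kappa> * mesh_size \<T>) \<subseteq> K)"

text \<open>Continuous piecewise linear functions, extended by zero to the whole space; by continuity
  they vanish on the boundary of the meshed region. They are differentiable off a null set
  (the element boundaries), and \<open>grad\<close> is there their elementwise gradient, which is their weak
  gradient.\<close>

definition fe_space :: "'a::euclidean_space set set \<Rightarrow> ('a \<Rightarrow> real) set" where
  "fe_space \<T> =
     {v. continuous_on UNIV v \<and> (\<forall>x. x \<notin> \<Union>\<T> \<longrightarrow> v x = 0) \<and>
         (\<forall>K\<in>\<T>. \<exists>p q. \<forall>x\<in>K. v x = p \<bullet> x + q)}"


section \<open>The L2-1-sigma scheme on the graded mesh\<close>

definition tgrid :: "real \<Rightarrow> real \<Rightarrow> nat \<Rightarrow> nat \<Rightarrow> real" where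
  "tgrid T r N n = T * (real n / real N) powr r"

definition tstep :: "real \<Rightarrow> real \<Rightarrow> nat \<Rightarrow> nat \<Rightarrow> real" where
  "tstep T r N n = tgrid T r N n - tgrid T r N (n - 1)"

definition sigma :: "real \<Rightarrow> real" where
  "sigma \<alpha> = \<alpha> / 2"

definition tsigma :: "real \<Rightarrow> real \<Rightarrow> real \<Rightarrow> nat \<Rightarrow> nat \<Rightarrow> real" where
  "tsigma \<alpha> T r N n =
     (1 - sigma \<alpha>) * tgrid T r N n + sigma \<alpha> * tgrid T r N (n - 1)"

definition acoef :: "real \<Rightarrow> real \<Rightarrow> real \<Rightarrow> nat \<Rightarrow> nat \<Rightarrow> nat \<Rightarrow> real" where
  "acoef \<alpha> T r N n j = 1 / Gamma (1 - \<alpha>) *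
     integral {tgrid T r N (j - 1) .. (if j = n then tsigma \<alpha> T r N n else tgrid T r N j)}
       (\<lambda>\<eta>. (tsigma \<alpha> T r N n - \<eta>) powr (- \<alpha>))"

text \<open>For \<open>j = 0\<close> only the value \<open>bcoef \<alpha> T r N 1 0 = 0\<close> matters.\<close>

definition bcoef :: "real \<Rightarrow> real \<Rightarrow> real \<Rightarrow> nat \<Rightarrow> nat \<Rightarrow> nat \<Rightarrow> real" where
  "bcoef \<alpha> T r N n j = (if j = 0 then 0 else
     2 / (Gamma (1 - \<alpha>) * (tgrid T r N (j + 1) - tgrid T r N (j - 1))) *
     integral {tgrid T r N (j - 1) .. tgrid T r N j}
       (\<lambda>\<eta>. (tsigma \<alpha> T r N n - \<eta>) powr (- \<alpha>) *
             (\<eta> - (tgrid T r N (j - 1) + tgrid T r N j) / 2)))"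

definition gcoef :: "real \<Rightarrow> real \<Rightarrow> real \<Rightarrow> nat \<Rightarrow> nat \<Rightarrow> nat \<Rightarrow> real" where
  "gcoef \<alpha> T r N n j =
     (if j = n then acoef \<alpha> T r N n n + bcoef \<alpha> T r N n (n - 1)
      else if j = 1 then acoef \<alpha> T r N n 1 - bcoef \<alpha> T r N n 1
      else acoef \<alpha> T r N n j + bcoef \<alpha> T r N n (j - 1) - bcoef \<alpha> T r N n j) / tstep T r N j"

definition L21sigma ::
    "real \<Rightarrow> real \<Rightarrow> real \<Rightarrow> nat \<Rightarrow> (nat \<Rightarrow> 'a \<Rightarrow> real) \<Rightarrow> nat \<Rightarrow> 'a \<Rightarrow> real" where
  "L21sigma \<alpha> T r N U n x = (\<Sum>j=1..n. gcoef \<alpha> T r N n j * (U j x - U (j - 1) x))"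

definition sigma_avg :: "real \<Rightarrow> (nat \<Rightarrow> 'a \<Rightarrow> real) \<Rightarrow> nat \<Rightarrow> 'a \<Rightarrow> real" where
  "sigma_avg \<alpha> U n x = (1 - sigma \<alpha>) * U n x + sigma \<alpha> * U (n - 1) x"

definition total :: "'a::euclidean_space set \<Rightarrow> ('a \<Rightarrow> real) \<Rightarrow> real" where
  "total \<Omega> w = (LINT x|lebesgue_on \<Omega>. w x)"

text \<open>The equation of the scheme at time level \<open>n\<close>; it involves \<open>U 0\<close>, ..., \<open>U n\<close> only.\<close>

definition scheme_at ::
    "real \<Rightarrow> real \<Rightarrow> real \<Rightarrow> nat \<Rightarrow> 'a::euclidean_space set \<Rightarrow> 'a set set \<Rightarrow> (real \<Rightarrow> real) \<Rightarrow>
     (real \<Rightarrow> 'a \<Rightarrow> real) \<Rightarrow> (nat \<Rightarrow> 'a \<Rightarrow> real) \<Rightarrow> nat \<Rightarrow> bool" where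
  "scheme_at \<alpha> T r N \<Omega> \<T> a f U n \<longleftrightarrow>
     (\<forall>v\<in>fe_space \<T>.
        L2_inner \<Omega> (L21sigma \<alpha> T r N U n) v +
        a (total \<Omega> (sigma_avg \<alpha> U n)) * L2_inner \<Omega> (grad (sigma_avg \<alpha> U n)) (grad v) =
        L2_inner \<Omega> (f (tsigma \<alpha> T r N n)) v)"

text \<open>The maximal norm of the values of \<open>f\<close> that enter the scheme.\<close>

definition source_max ::
    "real \<Rightarrow> real \<Rightarrow> real \<Rightarrow> nat \<Rightarrow> 'a::euclidean_space set \<Rightarrow> (real \<Rightarrow> 'a \<Rightarrow> real) \<Rightarrow> real" where
  "source_max \<alpha> T r N \<Omega> f = Max ((\<lambda>j. L2_norm \<Omega> (f (tsigma \<alpha> T r N j))) ` {1..N})"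

definition step_bound ::
    "real \<Rightarrow> real \<Rightarrow> real \<Rightarrow> nat \<Rightarrow> nat \<Rightarrow> real \<Rightarrow> real \<Rightarrow> real \<Rightarrow> real \<Rightarrow> real" where
  "step_bound \<alpha> T r N n m1 L C1 R1 =
     2 * m1 * (acoef \<alpha> T r N n n + bcoef \<alpha> T r N n (n - 1)) /
     ((1 - sigma \<alpha>) * (L * C1 * R1 * (1 - 2 * sigma \<alpha>))\<^sup>2)"

end

theory Submission
  imports Defs
begin

text \<open>In terms of \<open>W = U\<^sup>n\<^sup>,\<^sup>\<sigma>\<close> the step reads
  \<open>c (W, v) + a(l(W)) (\<nabla>W, \<nabla>v) = R(v)\<close> with \<open>c = g\<^sub>n\<^sub>,\<^sub>n / (1 - \<sigma>)\<close>. Freezing the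
  coefficient at \<open>a(s)\<close> gives a linear problem with a solution \<open>W\<^sub>s\<close>, and the intermediate value
  theorem yields a fixed point of the bounded continuous map \<open>s \<mapsto> l(W\<^sub>s)\<close>. Testing the
  difference \<open>E\<close> of two solutions with itself and using Young's inequality gives
  \<open>4 m\<^sub>1 c \<parallel>E\<parallel>\<^sup>2 \<le> L\<^sup>2 |\<Omega>| \<parallel>\<nabla>W\<parallel>\<^sup>2 \<parallel>E\<parallel>\<^sup>2\<close>, so the solution is unique once \<open>\<parallel>\<nabla>W\<parallel>\<close> is bounded
  independently of the discretization. For this bound, the weights satisfy
  \<open>K(t\<^sub>j\<^sub>-\<^sub>1) \<le> g\<^sub>n\<^sub>,\<^sub>j \<le> K(t\<^sub>j)\<close> for \<open>j < n\<close>, where \<open>K\<close> is the kernel of the fractional derivative,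
  and \<open>(1 - \<sigma>) K(t\<^sub>n\<^sub>-\<^sub>1) \<le> (1 - \<alpha>) g\<^sub>n\<^sub>,\<^sub>n\<close>. Hence
  \<open>D \<parallel>\<nabla>U\<parallel>\<^sup>2 \<le> 2 (\<nabla>W, \<nabla>DU)\<close>, where testing the scheme with \<open>DU\<close> bounds the right-hand side by the
  source; a discrete comparison principle then bounds \<open>\<parallel>\<nabla>U\<parallel>\<close> on all levels.\<close>

section \<open>The weights on the graded mesh\<close>

lemma has_integral_midpoint_moment:
  fixes c d :: real
  assumes "c \<le> d"
  shows "((\<lambda>x. x * (x - (c + d) / 2)) has_integral (d - c) ^ 3 / 12) {c..d}"
    and "((\<lambda>x. x - (c + d) / 2) has_integral 0) {c..d}"
proof -
  have "((\<lambda>x. x * (x - (c + d) / 2)) has_integral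
      ((d ^ 3 / 3 - (c + d) / 4 * d\<^sup>2) - (c ^ 3 / 3 - (c + d) / 4 * c\<^sup>2))) {c..d}"
    by (rule fundamental_theorem_of_calculus[OF assms])
      (auto intro!: derivative_eq_intros simp: has_real_derivative_iff_has_vector_derivative[symmetric]
        power2_eq_square algebra_simps)
  moreover have "(d ^ 3 / 3 - (c + d) / 4 * d\<^sup>2) - (c ^ 3 / 3 - (c + d) / 4 * c\<^sup>2) = (d - c) ^ 3 / 12"
    by (simp add: power3_eq_cube power2_eq_square field_simps)
  ultimately show "((\<lambda>x. x * (x - (c + d) / 2)) has_integral (d - c) ^ 3 / 12) {c..d}"
    by (simp only:)
  have "((\<lambda>x. x - (c + d) / 2) has_integral
      ((d\<^sup>2 / 2 - (c + d) / 2 * d) - (c\<^sup>2 / 2 - (c + d) / 2 * c))) {c..d}"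
    by (rule fundamental_theorem_of_calculus[OF assms])
      (auto intro!: derivative_eq_intros simp: has_real_derivative_iff_has_vector_derivative[symmetric])
  moreover have "(d\<^sup>2 / 2 - (c + d) / 2 * d) - (c\<^sup>2 / 2 - (c + d) / 2 * c) = 0"
    by (simp add: power2_eq_square field_simps)
  ultimately show "((\<lambda>x. x - (c + d) / 2) has_integral 0) {c..d}"
    by (simp only:)
qed

text \<open>A constant has zero moment about the midpoint, so an affine part contributes only
  through its slope. The freedom in \<open>p\<close> and \<open>q\<close> allows the integrand to be
  normalised before signs are compared.\<close>

lemma integral_midpoint_moment_shift:
  fixes h :: "real \<Rightarrow> real"
  assumes "c \<le> d" "continuous_on {c..d} h"
  shows "integral {c..d} (\<lambda>x. (h x - p * x - q) * (x - (c + d) / 2)) =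
    integral {c..d} (\<lambda>x. h x * (x - (c + d) / 2)) - p * ((d - c) ^ 3 / 12)"
proof -
  have "((\<lambda>x. h x * (x - (c + d) / 2)) has_integral
      integral {c..d} (\<lambda>x. h x * (x - (c + d) / 2))) {c..d}"
    by (intro integrable_integral integrable_continuous_real continuous_intros assms)
  from has_integral_diff[OF has_integral_diff[OF this
        has_integral_mult_right[OF has_integral_midpoint_moment(1)[OF assms(1)], of p]]
        has_integral_mult_right[OF has_integral_midpoint_moment(2)[OF assms(1)], of q]]
  moreover have "(h x - p * x - q) * y = h x * y - p * (x * y) - q * y" for x y
    by (simp add: algebra_simps)
  ultimately show ?thesis
    by (intro integral_unique) simp
qed

text \<open>Once the value at the midpoint is subtracted, both factors have the same sign on either
  side of it.\<close>

lemma integral_midpoint_mono_nonneg: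
  fixes h :: "real \<Rightarrow> real"
  assumes "c \<le> d" "continuous_on {c..d} h" "mono_on {c..d} h"
  shows "0 \<le> integral {c..d} (\<lambda>x. h x * (x - (c + d) / 2))"
proof -
  let ?m = "(c + d) / 2"
  have "0 \<le> integral {c..d} (\<lambda>x. (h x - 0 * x - h ?m) * (x - ?m))"
  proof (rule integral_nonneg)
    show "(\<lambda>x. (h x - 0 * x - h ?m) * (x - ?m)) integrable_on {c..d}"
      by (intro integrable_continuous_real continuous_intros assms)
    fix x
    assume "x \<in> {c..d}"
    then show "0 \<le> (h x - 0 * x - h ?m) * (x - ?m)"
      using mono_onD[OF assms(3), of x ?m] mono_onD[OF assms(3), of ?m x] assms(1)
      by (cases "x \<le> ?m") (auto simp: mult_nonneg_nonneg mult_nonpos_nonpos)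
  qed
  then show ?thesis
    using integral_midpoint_moment_shift[OF assms(1,2), of 0] by simp
qed

text \<open>Subtracting \<open>h c\<close> makes the first factor nonnegative, and the second is at
  most half the length of the interval.\<close>

lemma integral_midpoint_le:
  fixes h :: "real \<Rightarrow> real"
  assumes "c \<le> d" "continuous_on {c..d} h" "mono_on {c..d} h"
  shows "integral {c..d} (\<lambda>x. h x * (x - (c + d) / 2)) \<le>
    (d - c) / 2 * (integral {c..d} h - h c * (d - c))"
proof -
  let ?m = "(c + d) / 2"
  have "integral {c..d} (\<lambda>x. h x * (x - ?m)) = integral {c..d} (\<lambda>x. (h x - 0 * x - h c) * (x - ?m))"
    using integral_midpoint_moment_shift[OF assms(1,2), of 0] by simp
  also have "\<dots> \<le> integral {c..d} (\<lambda>x. (d - c) / 2 * (h x - h c))"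
  proof (rule integral_le)
    fix x
    assume x: "x \<in> {c..d}"
    then have "(h x - h c) * (x - ?m) \<le> (h x - h c) * ((d - c) / 2)"
      using mono_onD[OF assms(3), of c x] by (intro mult_left_mono) (auto simp: field_simps)
    then show "(h x - 0 * x - h c) * (x - ?m) \<le> (d - c) / 2 * (h x - h c)"
      by (simp add: mult.commute)
  qed (intro integrable_continuous_real continuous_intros assms)+
  also have "\<dots> = (d - c) / 2 * (integral {c..d} h - h c * (d - c))"
    using integrable_continuous_real[OF assms(2)] assms(1)
    by (subst integral_mult_right, subst integral_diff) (auto simp: algebra_simps)
  finally show ?thesis .
qed

text \<open>Subtracting a line of slope \<open>p = h' d\<close> makes a function with increasing derivative
  decreasing to the left of \<open>d\<close> and increasing to the right of it; this compares the first
  moments on two adjacent intervals with those of the line.\<close>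

lemma integral_midpoint_le_slope:
  fixes h h' :: "real \<Rightarrow> real"
  assumes "c \<le> d" "\<And>x. x \<in> {c..d} \<Longrightarrow> (h has_real_derivative h' x) (at x)"
    and "\<And>x. x \<in> {c..d} \<Longrightarrow> h' x \<le> p"
  shows "integral {c..d} (\<lambda>x. h x * (x - (c + d) / 2)) \<le> p * ((d - c) ^ 3 / 12)"
proof -
  have cont: "continuous_on {c..d} h"
    using assms(2) by (meson DERIV_isCont continuous_at_imp_continuous_on)
  have "mono_on {c..d} (\<lambda>x. p * x - h x)"
  proof (rule mono_onI)
    fix x y
    assume xy: "x \<in> {c..d}" "y \<in> {c..d}" "x \<le> y"
    show "p * x - h x \<le> p * y - h y"
    proof (rule DERIV_nonneg_imp_nondecreasing[OF xy(3)])
      fix z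
      assume "x \<le> z" "z \<le> y"
      then have "z \<in> {c..d}"
        using xy by auto
      then show "\<exists>D. ((\<lambda>x. p * x - h x) has_real_derivative D) (at z) \<and> 0 \<le> D"
        using assms(2,3)[of z] by (intro exI[of _ "p - h' z"]) (auto intro!: derivative_eq_intros)
    qed
  qed
  then have "0 \<le> integral {c..d} (\<lambda>x. (p * x - h x) * (x - (c + d) / 2))"
    by (intro integral_midpoint_mono_nonneg assms continuous_intros cont)
  also have "\<dots> = integral {c..d} (\<lambda>x. - ((h x - p * x - 0) * (x - (c + d) / 2)))"
    by (intro integral_cong) (simp only: mult_minus_left[symmetric] minus_diff_eq diff_0_right)
  also have "\<dots> = - (integral {c..d} (\<lambda>x. h x * (x - (c + d) / 2)) - p * ((d - c) ^ 3 / 12))"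
    unfolding integral_neg integral_midpoint_moment_shift[OF assms(1) cont] ..
  finally show ?thesis
    by simp
qed

lemma integral_midpoint_ge_slope:
  fixes h h' :: "real \<Rightarrow> real"
  assumes "c \<le> d" "\<And>x. x \<in> {c..d} \<Longrightarrow> (h has_real_derivative h' x) (at x)"
    and "\<And>x. x \<in> {c..d} \<Longrightarrow> p \<le> h' x"
  shows "p * ((d - c) ^ 3 / 12) \<le> integral {c..d} (\<lambda>x. h x * (x - (c + d) / 2))"
proof -
  have "integral {c..d} (\<lambda>x. - h x * (x - (c + d) / 2)) \<le> - p * ((d - c) ^ 3 / 12)"
    by (rule integral_midpoint_le_slope[where h' = "\<lambda>x. - h' x"])
      (use assms in \<open>auto intro!: derivative_eq_intros\<close>)
  then show ?thesis
    by (simp add: integral_neg)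
qed

section \<open>Growth and log-concavity of the steps of the graded mesh\<close>

lemma tgrid_less:
  assumes "0 < T" "1 \<le> r" "0 < N" "i < j"
  shows "tgrid T r N i < tgrid T r N j"
  unfolding tgrid_def using assms
  by (intro mult_strict_left_mono powr_less_mono2 divide_strict_right_mono) auto

lemma tgrid_mono:
  assumes "0 < T" "1 \<le> r" "0 < N" "i \<le> j"
  shows "tgrid T r N i \<le> tgrid T r N j"
  using tgrid_less[OF assms(1-3), of i j] assms(4) by (cases "i = j") auto

lemma tstep_pos:
  assumes "0 < T" "1 \<le> r" "0 < N" "1 \<le> j"
  shows "0 < tstep T r N j"
  using tgrid_less[OF assms(1-3), of "j - 1" j] assms(4) by (simp add: tstep_def)

lemma mvt_real_derivative:
  fixes f :: "real \<Rightarrow> real"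
  assumes "a < b" "continuous_on {a..b} f"
    and "\<And>x. a < x \<Longrightarrow> x < b \<Longrightarrow> (f has_real_derivative f' x) (at x)"
  obtains z where "a < z" "z < b" "f b - f a = (b - a) * f' z"
proof -
  obtain z where "a < z" "z < b" "f b - f a = (\<lambda>h. h * f' z) (b - a)"
    by (rule mvt[OF assms(1,2), of "\<lambda>x h. h * f' x"])
      (use assms(3) in \<open>auto simp: has_field_derivative_def mult_commute_abs\<close>)
  then show ?thesis
    using that by auto
qed

text \<open>Cauchy's mean value theorem gives the ratio of consecutive steps as
  \<open>(\<xi> / (\<xi> - 1)) powr (r - 1)\<close>, which decreases in \<open>\<xi>\<close>.\<close>

lemma tstep_ratio:
  assumes "0 < T" "1 \<le> r" "0 < N" "1 \<le> j"
  obtains \<xi> where "real j < \<xi>" "\<xi> < real j + 1"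
    "tstep T r N (Suc j) = tstep T r N j * (\<xi> / (\<xi> - 1)) powr (r - 1)"
proof -
  \<comment> \<open>Up to the common factor \<open>T / real N powr r\<close>, the later step is the
    increment of \<open>?f\<close> and the earlier one that of \<open>?g\<close> over the same
    interval; the shift by one in \<open>?g\<close> makes Cauchy's theorem applicable.\<close>
  let ?f = "\<lambda>y::real. y powr r" and ?g = "\<lambda>y::real. (y - 1) powr r"
  let ?A = "?f (real j + 1) - ?f (real j)" and ?B = "?g (real j + 1) - ?g (real j)"
  obtain \<xi> where \<xi>: "real j < \<xi>" "\<xi> < real j + 1" and *:
    "(?A * ?g (real j + 1) - ?B * ?f (real j + 1)) - (?A * ?g (real j) - ?B * ?f (real j)) =
      (real j + 1 - real j) * (?A * (r * (\<xi> - 1) powr (r - 1)) - ?B * (r * \<xi> powr (r - 1)))"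
  proof (rule mvt_real_derivative)
    show "continuous_on {real j..real j + 1} (\<lambda>y. ?A * ?g y - ?B * ?f y)"
      using assms by (intro continuous_intros continuous_on_powr') auto
  next
    fix z
    assume z: "real j < z" "z < real j + 1"
    show "((\<lambda>y. ?A * ?g y - ?B * ?f y) has_real_derivative
        ?A * (r * (z - 1) powr (r - 1)) - ?B * (r * z powr (r - 1))) (at z)"
      using z assms by (auto intro!: derivative_eq_intros)
  qed simp
  \<comment> \<open>The auxiliary function takes the same value at both ends, so the left-hand side
    of the mean value identity vanishes.\<close>
  have "r * (?A * (\<xi> - 1) powr (r - 1) - ?B * \<xi> powr (r - 1)) = 0"
    using * by (simp add: algebra_simps)
  then have eq: "?A * (\<xi> - 1) powr (r - 1) = ?B * \<xi> powr (r - 1)"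
    using assms(2) by simp
  have "1 < \<xi>"
    using \<xi> assms by linarith
  then have ratio: "(\<xi> / (\<xi> - 1)) powr (r - 1) = \<xi> powr (r - 1) / (\<xi> - 1) powr (r - 1)"
    "0 < (\<xi> - 1) powr (r - 1)"
    by (auto simp: powr_divide)
  have t: "tgrid T r N i = T / real N powr r * real i powr r" for i
    using assms by (simp add: tgrid_def powr_divide)
  have *: "?f (real j + 1) - ?f (real j) =
      (?g (real j + 1) - ?g (real j)) * (\<xi> powr (r - 1) / (\<xi> - 1) powr (r - 1))"
    using eq ratio(2) by (simp only: times_divide_eq_right eq_divide_eq) simp
  have "real (Suc j) = real j + 1" "real (j - 1) = real j - 1"
    using assms by auto
  then have "tstep T r N (Suc j) = T / real N powr r * ?A" "tstep T r N j = T / real N powr r * ?B"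
    by (simp_all only: tstep_def t right_diff_distrib diff_Suc_1 add_diff_cancel_right')
  then have "tstep T r N (Suc j) = tstep T r N j * (\<xi> / (\<xi> - 1)) powr (r - 1)"
    unfolding ratio(1) using * by (simp only: mult.assoc)
  with \<xi> show ?thesis
    using that by blast
qed

lemma tstep_mono:
  assumes "0 < T" "1 \<le> r" "0 < N" "1 \<le> j"
  shows "tstep T r N j \<le> tstep T r N (Suc j)"
proof -
  obtain \<xi> where \<xi>: "real j < \<xi>" "tstep T r N (Suc j) = tstep T r N j * (\<xi> / (\<xi> - 1)) powr (r - 1)"
    using tstep_ratio[OF assms] by metis
  have "1 \<le> (\<xi> / (\<xi> - 1)) powr (r - 1)"
    using \<xi>(1) assms by (intro ge_one_powr_ge_zero) auto
  then show ?thesis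
    using \<xi>(2) tstep_pos[OF assms] by simp
qed

text \<open>The intermediate points satisfy \<xi> < j + 1 < \<eta>, and the ratio of consecutive
  steps is smaller at the point further to the right.\<close>

lemma tstep_log_concave:
  assumes "0 < T" "1 \<le> r" "0 < N" "1 \<le> j"
  shows "tstep T r N j * tstep T r N (Suc (Suc j)) \<le> (tstep T r N (Suc j))\<^sup>2"
proof -
  obtain \<xi> where \<xi>: "real j < \<xi>" "\<xi> < real j + 1"
    "tstep T r N (Suc j) = tstep T r N j * (\<xi> / (\<xi> - 1)) powr (r - 1)"
    using tstep_ratio[OF assms] by metis
  obtain \<eta> where \<eta>: "real (Suc j) < \<eta>"
    "tstep T r N (Suc (Suc j)) = tstep T r N (Suc j) * (\<eta> / (\<eta> - 1)) powr (r - 1)"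
    using tstep_ratio[OF assms(1-3), of "Suc j"] by (metis le_add1 plus_1_eq_Suc)
  have "(\<eta> / (\<eta> - 1)) powr (r - 1) \<le> (\<xi> / (\<xi> - 1)) powr (r - 1)"
    using \<xi>(1,2) \<eta>(1) assms by (intro powr_mono2) (auto simp: field_simps)
  then have "tstep T r N j * tstep T r N (Suc j) * (\<eta> / (\<eta> - 1)) powr (r - 1) \<le>
      tstep T r N j * tstep T r N (Suc j) * (\<xi> / (\<xi> - 1)) powr (r - 1)"
    using tstep_pos[OF assms] tstep_pos[OF assms(1-3), of "Suc j"] by (intro mult_left_mono) auto
  moreover have "tstep T r N j * tstep T r N (Suc (Suc j)) =
      tstep T r N j * tstep T r N (Suc j) * (\<eta> / (\<eta> - 1)) powr (r - 1)"
    by (subst \<eta>(2)) (rule mult.assoc[symmetric])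
  moreover have "(tstep T r N (Suc j))\<^sup>2 =
      tstep T r N j * tstep T r N (Suc j) * (\<xi> / (\<xi> - 1)) powr (r - 1)"
    unfolding power2_eq_square by (subst (2) \<xi>(3)) (simp only: mult_ac)
  ultimately show ?thesis
    by linarith
qed

text \<open>Needed to compare consecutive coefficients \<open>bcoef\<close>: the cubes come from the
  moments of a line, the sums from the denominators. With steps x, y, z the two summands are
  estimated separately, the one with z through x z \<le> y * y.\<close>

lemma tstep_cubes:
  assumes "0 < T" "1 \<le> r" "0 < N" "1 \<le> j"
  shows "(tstep T r N j) ^ 3 * (tstep T r N (Suc j) + tstep T r N (Suc (Suc j))) \<le>
    (tstep T r N (Suc j)) ^ 3 * (tstep T r N j + tstep T r N (Suc j))"
proof -
  define x y z where "x = tstep T r N j" "y = tstep T r N (Suc j)" "z = tstep T r N (Suc (Suc j))"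
  have xy: "0 < x" "x \<le> y" and xz: "x * z \<le> y\<^sup>2"
    using tstep_pos[OF assms] tstep_mono[OF assms] tstep_log_concave[OF assms]
    by (auto simp: x_y_z_def)
  have "x ^ 3 * y \<le> y ^ 3 * y"
    using xy by (intro mult_right_mono power_mono) auto
  moreover have "x\<^sup>2 * (x * z) \<le> x\<^sup>2 * y\<^sup>2"
    using xz by (intro mult_left_mono) auto
  moreover have "x * y\<^sup>2 * x \<le> x * y\<^sup>2 * y"
    using xy by (intro mult_left_mono) auto
  ultimately show ?thesis
    unfolding x_y_z_def[symmetric] by (simp add: power2_eq_square power3_eq_cube algebra_simps)
qed

section \<open>Comparison of the weights with values of the kernel\<close>

locale graded_mesh =
  fixes \<alpha> T r :: real and N :: nat
  assumes alpha: "0 < \<alpha>" "\<alpha> < 1" and T: "0 < T" and r: "1 \<le> r" and N: "0 < N"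
begin

abbreviation "t \<equiv> tgrid T r N"
abbreviation "\<tau> \<equiv> tstep T r N"
abbreviation "\<sigma> \<equiv> sigma \<alpha>"
abbreviation "ts \<equiv> tsigma \<alpha> T r N"
abbreviation "g \<equiv> gcoef \<alpha> T r N"
abbreviation "G \<equiv> Gamma (1 - \<alpha>)"

text \<open>The factor \<open>1 / G\<close> of the fractional derivative is left out, so bounds on
  the weights involve \<open>kernel n \<eta> / G\<close>.\<close>

definition kernel :: "nat \<Rightarrow> real \<Rightarrow> real" where
  "kernel n \<eta> = (ts n - \<eta>) powr (- \<alpha>)"

lemmas t_mono = tgrid_mono[OF T r N]
lemmas \<tau>_pos = tstep_pos[OF T r N]
lemmas \<tau>_cubes = tstep_cubes[OF T r N]

lemma G_pos: "0 < G"
  using alpha by (intro Gamma_real_pos) simp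

lemma \<sigma>_bounds: "0 < \<sigma>" "\<sigma> < 1 / 2" "1 - 2 * \<sigma> = 1 - \<alpha>"
  using alpha by (auto simp: sigma_def)

lemma ts_diff: "ts n - t (n - 1) = (1 - \<sigma>) * \<tau> n"
  by (simp add: tsigma_def tstep_def algebra_simps)

lemma ts_gt:
  assumes "1 \<le> n"
  shows "t (n - 1) < ts n"
proof -
  have "0 < (1 - \<sigma>) * \<tau> n"
    using \<tau>_pos[OF assms] \<sigma>_bounds by simp
  then show ?thesis
    using ts_diff[of n] by simp
qed

lemma t_less_ts:
  assumes "j < n"
  shows "t j < ts n"
proof -
  have "t j \<le> t (n - 1)"
    using assms by (intro t_mono) simp
  also have "\<dots> < ts n"
    using assms by (intro ts_gt) simp
  finally show ?thesis .
qed

lemma ts_le: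
  assumes "1 \<le> n"
  shows "ts n \<le> t n"
proof -
  have "0 \<le> \<sigma> * \<tau> n"
    using \<tau>_pos[OF assms] \<sigma>_bounds by simp
  moreover have "ts n = t n - \<sigma> * \<tau> n"
    by (simp add: tsigma_def tstep_def algebra_simps)
  ultimately show ?thesis
    by simp
qed

lemma kernel_deriv:
  "\<eta> < ts n \<Longrightarrow>
    (kernel n has_real_derivative \<alpha> * (ts n - \<eta>) powr (- \<alpha> - 1)) (at \<eta>)"
  unfolding kernel_def[abs_def] by (auto intro!: derivative_eq_intros)

lemma kernel_mono: "\<eta> \<le> \<zeta> \<Longrightarrow> \<zeta> < ts n \<Longrightarrow> kernel n \<eta> \<le> kernel n \<zeta>"
  unfolding kernel_def using alpha by (intro powr_mono2') auto

lemma kernel_nonneg: "0 \<le> kernel n \<eta>"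
  by (simp add: kernel_def)

lemma kernel_continuous:
  assumes "j < n"
  shows "continuous_on {t (j - 1)..t j} (kernel n)"
  by (rule continuous_at_imp_continuous_on)
    (use t_less_ts[OF assms] in \<open>auto intro!: DERIV_isCont[OF kernel_deriv]\<close>)

lemma kernel_mono_on:
  assumes "j < n"
  shows "mono_on {t (j - 1)..t j} (kernel n)"
  by (rule mono_onI) (use t_less_ts[OF assms] in \<open>auto intro!: kernel_mono\<close>)

definition kint :: "nat \<Rightarrow> nat \<Rightarrow> real" where
  "kint n j = integral {t (j - 1)..t j} (kernel n)"

definition kmom :: "nat \<Rightarrow> nat \<Rightarrow> real" where
  "kmom n j = integral {t (j - 1)..t j} (\<lambda>\<eta>. kernel n \<eta> * (\<eta> - (t (j - 1) + t j) / 2))"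

lemma acoef_eq: "j < n \<Longrightarrow> acoef \<alpha> T r N n j = kint n j / G"
  by (simp add: acoef_def kint_def kernel_def[abs_def])

lemma bcoef_eq:
  "1 \<le> j \<Longrightarrow> bcoef \<alpha> T r N n j = 2 * kmom n j / (G * (\<tau> j + \<tau> (Suc j)))"
  by (simp add: bcoef_def kmom_def kernel_def[abs_def] tstep_def)

lemma kint_bounds:
  assumes "j < n"
  shows "kernel n (t (j - 1)) * \<tau> j \<le> kint n j" "kint n j \<le> kernel n (t j) * \<tau> j"
proof -
  have int: "(kernel n has_integral kint n j) {t (j - 1)..t j}"
    unfolding kint_def
    by (intro integrable_integral integrable_continuous_real kernel_continuous assms)
  have const: "((\<lambda>_. c) has_integral c * \<tau> j) {t (j - 1)..t j}" for c :: real
    using has_integral_const_real[of c "t (j - 1)" "t j"] t_mono[of "j - 1" j]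
    by (simp add: tstep_def mult.commute)
  show "kernel n (t (j - 1)) * \<tau> j \<le> kint n j"
    by (rule has_integral_le[OF const int]) (use t_less_ts[OF assms] in \<open>auto intro: kernel_mono\<close>)
  show "kint n j \<le> kernel n (t j) * \<tau> j"
    by (rule has_integral_le[OF int const]) (use t_less_ts[OF assms] in \<open>auto intro: kernel_mono\<close>)
qed

lemma kmom_nonneg: "j < n \<Longrightarrow> 0 \<le> kmom n j"
  unfolding kmom_def
  by (intro integral_midpoint_mono_nonneg kernel_continuous kernel_mono_on t_mono) auto

lemma kmom_le: "j < n \<Longrightarrow> kmom n j \<le> \<tau> j / 2 * (kint n j - kernel n (t (j - 1)) * \<tau> j)"
  unfolding kmom_def kint_def tstep_def
  by (intro integral_midpoint_le kernel_continuous kernel_mono_on t_mono) auto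

lemma bcoef_nonneg:
  assumes "j < n"
  shows "0 \<le> bcoef \<alpha> T r N n j"
proof (cases "j = 0")
  case False
  then show ?thesis
    using kmom_nonneg[OF assms] G_pos \<tau>_pos[of j] \<tau>_pos[of "Suc j"] by (simp add: bcoef_eq)
qed (simp add: bcoef_def)

text \<open>The quotient of \<open>\<tau> j\<close> by the sum of two steps is at most 1.
  Subtracting this coefficient from \<open>acoef\<close> therefore costs no more than the excess of
  the kernel over its value at the left endpoint.\<close>

lemma bcoef_le:
  assumes "1 \<le> j" "j < n"
  shows "bcoef \<alpha> T r N n j \<le> (kint n j - kernel n (t (j - 1)) * \<tau> j) / G"
proof -
  let ?d = "kint n j - kernel n (t (j - 1)) * \<tau> j"
  have \<tau>: "0 < \<tau> j" "0 < \<tau> (Suc j)"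
    using \<tau>_pos[of j] \<tau>_pos[of "Suc j"] assms by auto
  have "2 * kmom n j \<le> ?d * \<tau> j"
    using kmom_le[OF assms(2)] by (simp add: algebra_simps)
  also have "\<dots> \<le> ?d * (\<tau> j + \<tau> (Suc j))"
    using kint_bounds(1)[OF assms(2)] \<tau> by (intro mult_left_mono) auto
  finally show ?thesis
    using G_pos \<tau> assms(1) by (simp add: bcoef_eq divide_simps mult_ac)
qed

text \<open>The kernel is convex, so its slope is at most \<open>p\<close>, the slope at the common
  endpoint \<open>t j\<close>, on the left interval and at least \<open>p\<close> on the right one.
  Both moments are compared with those of a line of slope \<open>p\<close>, and
  \<open>\<tau>_cubes\<close> settles the rest. For \<open>j = 0\<close> the convention for
  \<open>bcoef\<close> leaves only nonnegativity.\<close>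

lemma bcoef_mono:
  assumes "Suc j < n"
  shows "bcoef \<alpha> T r N n j \<le> bcoef \<alpha> T r N n (Suc j)"
proof (cases "j = 0")
  case True
  then show ?thesis
    using bcoef_nonneg[OF assms] by (simp add: bcoef_def)
next
  case False
  define p where "p = \<alpha> * (ts n - t j) powr (- \<alpha> - 1)"
  have "0 \<le> p"
    using alpha by (simp add: p_def)
  have "t j < ts n" "t (Suc j) < ts n"
    using assms by (auto intro: t_less_ts)
  have upper: "kmom n j \<le> p * (\<tau> j ^ 3 / 12)"
    unfolding kmom_def tstep_def
  proof (rule integral_midpoint_le_slope)
    fix x
    assume "x \<in> {t (j - 1)..t j}"
    then show "(kernel n has_real_derivative \<alpha> * (ts n - x) powr (- \<alpha> - 1)) (at x)"
      "\<alpha> * (ts n - x) powr (- \<alpha> - 1) \<le> p"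
      unfolding p_def using \<open>t j < ts n\<close> alpha
      by (auto intro!: kernel_deriv mult_left_mono powr_mono2')
  qed (simp add: t_mono)
  have lower: "p * (\<tau> (Suc j) ^ 3 / 12) \<le> kmom n (Suc j)"
    unfolding kmom_def tstep_def
  proof (rule integral_midpoint_ge_slope)
    fix x
    assume "x \<in> {t (Suc j - 1)..t (Suc j)}"
    then show "(kernel n has_real_derivative \<alpha> * (ts n - x) powr (- \<alpha> - 1)) (at x)"
      "p \<le> \<alpha> * (ts n - x) powr (- \<alpha> - 1)"
      unfolding p_def using \<open>t (Suc j) < ts n\<close> alpha
      by (auto intro!: kernel_deriv mult_left_mono powr_mono2')
  qed (simp add: t_mono)
  have \<tau>: "0 < \<tau> j" "0 < \<tau> (Suc j)" "0 < \<tau> (Suc (Suc j))"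
    using \<tau>_pos False by auto
  have "kmom n j * (\<tau> (Suc j) + \<tau> (Suc (Suc j))) \<le>
      p * (\<tau> j ^ 3 / 12) * (\<tau> (Suc j) + \<tau> (Suc (Suc j)))"
    using upper \<tau> by (intro mult_right_mono) auto
  also have "\<dots> = p / 12 * (\<tau> j ^ 3 * (\<tau> (Suc j) + \<tau> (Suc (Suc j))))"
    by simp
  also have "\<dots> \<le> p / 12 * (\<tau> (Suc j) ^ 3 * (\<tau> j + \<tau> (Suc j)))"
    using \<open>0 \<le> p\<close> \<tau>_cubes[of j] False by (intro mult_left_mono) auto
  also have "\<dots> = p * (\<tau> (Suc j) ^ 3 / 12) * (\<tau> j + \<tau> (Suc j))"
    by simp
  also have "\<dots> \<le> kmom n (Suc j) * (\<tau> j + \<tau> (Suc j))"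
    using lower \<tau> by (intro mult_right_mono) auto
  finally have "kmom n j * (\<tau> (Suc j) + \<tau> (Suc (Suc j))) \<le> kmom n (Suc j) * (\<tau> j + \<tau> (Suc j))" .
  then have "kmom n j / (\<tau> j + \<tau> (Suc j)) \<le> kmom n (Suc j) / (\<tau> (Suc j) + \<tau> (Suc (Suc j)))"
    using \<tau> by (simp add: divide_simps)
  then have "2 / G * (kmom n j / (\<tau> j + \<tau> (Suc j))) \<le>
      2 / G * (kmom n (Suc j) / (\<tau> (Suc j) + \<tau> (Suc (Suc j))))"
    using G_pos by (intro mult_left_mono) auto
  then show ?thesis
    using False by (simp add: bcoef_eq)
qed

text \<open>The singular integral is explicit: with \<open>s\<close> the distance from
  \<open>t (n - 1)\<close> to \<open>ts n\<close> it equals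
  \<open>s powr (1 - \<alpha>) / (1 - \<alpha>)\<close>, and \<open>s powr (1 - \<alpha>)\<close> is
  \<open>s\<close> times the kernel at \<open>t (n - 1)\<close>. The factor
  \<open>1 - \<alpha>\<close> is what gives the diagonal weight its dominance.\<close>

lemma acoef_diag: "1 \<le> n \<Longrightarrow> (1 - \<alpha>) * acoef \<alpha> T r N n n = (1 - \<sigma>) * \<tau> n * kernel n (t (n - 1)) / G"
proof -
  assume n: "1 \<le> n"
  define s where "s = (1 - \<sigma>) * \<tau> n"
  have s: "0 < s"
    unfolding s_def using \<sigma>_bounds \<tau>_pos[OF n] by simp
  have ts: "ts n = t (n - 1) + s"
    using ts_diff[of n] by (simp add: s_def)
  have "((\<lambda>x. x powr (- \<alpha>)) has_integral s powr (1 - \<alpha>) / (1 - \<alpha>)) {0..s}"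
    using has_integral_powr_from_0[of "- \<alpha>" s] alpha s by (simp add: add.commute)
  then have "((\<lambda>x. x powr (- \<alpha>)) has_integral s powr (1 - \<alpha>) / (1 - \<alpha>)) (cbox 0 s)"
    by simp
  from has_integral_affinity[OF this, of "- 1" "ts n"]
  have "((\<lambda>\<eta>. (ts n - \<eta>) powr (- \<alpha>)) has_integral s powr (1 - \<alpha>) / (1 - \<alpha>))
      ((\<lambda>x. ts n - x) ` {0..s})"
    by (simp add: algebra_simps)
  moreover have "(\<lambda>x. ts n - x) ` {0..s} = {t (n - 1)..ts n}"
    by (subst image_diff_atLeastAtMost) (simp add: ts)
  ultimately have "((\<lambda>\<eta>. (ts n - \<eta>) powr (- \<alpha>)) has_integral s powr (1 - \<alpha>) / (1 - \<alpha>))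
      {t (n - 1)..ts n}"
    by (simp only:)
  then have "acoef \<alpha> T r N n n = 1 / G * (s powr (1 - \<alpha>) / (1 - \<alpha>))"
    unfolding acoef_def by (simp add: integral_unique)
  moreover have "s powr (1 - \<alpha>) = s * kernel n (t (n - 1))"
    unfolding kernel_def using s ts by (simp add: powr_diff powr_minus divide_inverse)
  ultimately show ?thesis
    using alpha by (simp add: s_def)
qed

text \<open>Because \<open>bcoef\<close> vanishes at index 0, the first weight fits the general
  formula.\<close>

lemma gcoef_off_diag:
  "1 \<le> j \<Longrightarrow> j < n \<Longrightarrow>
    g n j = (kint n j / G + bcoef \<alpha> T r N n (j - 1) - bcoef \<alpha> T r N n j) / \<tau> j"
  by (auto simp: gcoef_def acoef_eq bcoef_def)

text \<open>The lower bound drops the nonnegative coefficient at \<open>j - 1\<close> and pays for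
  the one at \<open>j\<close> with \<open>bcoef_le\<close>; the upper bound uses that
  \<open>bcoef\<close> increases in \<open>j\<close>.\<close>

lemma gcoef_off_diag_bounds:
  assumes "1 \<le> j" "j < n"
  shows "kernel n (t (j - 1)) / G \<le> g n j" "g n j \<le> kernel n (t j) / G"
proof -
  have \<tau>: "0 < \<tau> j"
    using \<tau>_pos assms by simp
  have "0 \<le> bcoef \<alpha> T r N n (j - 1)" "bcoef \<alpha> T r N n (j - 1) \<le> bcoef \<alpha> T r N n j"
    using bcoef_nonneg[of "j - 1" n] bcoef_mono[of "j - 1" n] assms by auto
  moreover have "kint n j / G \<le> kernel n (t j) * \<tau> j / G"
    using kint_bounds(2)[OF assms(2)] G_pos by (simp add: divide_right_mono)
  moreover have "kernel n (t (j - 1)) * \<tau> j / G + bcoef \<alpha> T r N n j \<le> kint n j / G"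
    using bcoef_le[OF assms] by (simp add: diff_divide_distrib)
  ultimately show "kernel n (t (j - 1)) / G \<le> g n j" "g n j \<le> kernel n (t j) / G"
    unfolding gcoef_off_diag[OF assms] using \<tau> by (simp_all add: pos_le_divide_eq pos_divide_le_eq)
qed

lemma gcoef_diag_ge:
  assumes "1 \<le> n"
  shows "(1 - \<sigma>) * (kernel n (t (n - 1)) / G) \<le> (1 - \<alpha>) * g n n"
proof -
  have "(1 - \<sigma>) * \<tau> n * kernel n (t (n - 1)) / G \<le>
      (1 - \<alpha>) * (acoef \<alpha> T r N n n + bcoef \<alpha> T r N n (n - 1))"
    using acoef_diag[OF assms] bcoef_nonneg[of "n - 1" n] assms alpha by (simp add: distrib_left)
  then show ?thesis
    using \<tau>_pos[OF assms] by (simp add: gcoef_def pos_le_divide_eq mult_ac)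
qed

lemma kernel_le_gcoef_diag:
  assumes "1 \<le> n"
  shows "kernel n (t (n - 1)) / G \<le> g n n"
proof -
  have "(1 - \<alpha>) * (kernel n (t (n - 1)) / G) \<le> (1 - \<sigma>) * (kernel n (t (n - 1)) / G)"
    using \<sigma>_bounds kernel_nonneg G_pos by (intro mult_right_mono) (auto simp: sigma_def)
  also have "\<dots> \<le> (1 - \<alpha>) * g n n"
    by (rule gcoef_diag_ge[OF assms])
  finally show ?thesis
    using alpha by (simp only: mult_le_cancel_left_pos diff_gt_0_iff_gt)
qed

text \<open>The kernel value at \<open>t j\<close> separates the two weights.\<close>

lemma gcoef_mono:
  assumes "1 \<le> j" "j < n"
  shows "g n j \<le> g n (Suc j)"
proof -
  have "kernel n (t j) / G \<le> g n (Suc j)"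
  proof (cases "Suc j = n")
    case True
    then show ?thesis
      using kernel_le_gcoef_diag[of n] by auto
  next
    case False
    then show ?thesis
      using gcoef_off_diag_bounds(1)[of "Suc j" n] assms by simp
  qed
  with gcoef_off_diag_bounds(2)[OF assms] show ?thesis
    by linarith
qed

text \<open>Both weights are compared with the kernel at \<open>t (n - 1)\<close>; here
  \<open>\<sigma> = \<alpha> / 2\<close> matters, since it turns \<open>1 - \<alpha>\<close> into
  \<open>1 - 2 * \<sigma>\<close>. This is the hypothesis \<open>dom\<close> of
  \<open>increments_inner_ge\<close>.\<close>

lemma gcoef_diag_dominates:
  assumes "2 \<le> n"
  shows "(1 - \<sigma>)\<^sup>2 * g n (n - 1) \<le> (1 - 2 * \<sigma>) * g n n"
proof -
  have le: "g n (n - 1) \<le> kernel n (t (n - 1)) / G"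
    using gcoef_off_diag_bounds(2)[of "n - 1" n] assms by simp
  have "(1 - \<sigma>)\<^sup>2 * g n (n - 1) \<le> (1 - \<sigma>)\<^sup>2 * (kernel n (t (n - 1)) / G)"
    using le by (intro mult_left_mono) auto
  also have "\<dots> \<le> (1 - \<sigma>) * (kernel n (t (n - 1)) / G)"
    using \<sigma>_bounds kernel_nonneg G_pos
    by (intro mult_right_mono) (auto simp: power2_eq_square mult_left_le)
  also have "\<dots> \<le> (1 - 2 * \<sigma>) * g n n"
    using gcoef_diag_ge[of n] assms \<sigma>_bounds by simp
  finally show ?thesis .
qed

text \<open>All evaluation points lie in (0, T], where the kernel of the memory at time 0 is
  smallest for the distance \<open>T\<close>. The bound does not depend on \<open>n\<close> or
  \<open>N\<close>, which makes the energy bound uniform.\<close>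

lemma gcoef_first_ge:
  assumes "1 \<le> n" "n \<le> N"
  shows "T powr (- \<alpha>) / G \<le> g n 1"
proof -
  have "ts n \<le> T"
    using ts_le[OF assms(1)] t_mono[OF assms(2)] N by (simp add: tgrid_def)
  moreover have "t 0 = 0" "0 < ts n"
    using t_less_ts[of 0 n] assms by (auto simp: tgrid_def)
  ultimately have "T powr (- \<alpha>) \<le> kernel n (t 0)"
    unfolding kernel_def using alpha by (intro powr_mono2') auto
  then have "T powr (- \<alpha>) / G \<le> kernel n (t 0) / G"
    using G_pos by (simp add: divide_right_mono)
  also have "\<dots> \<le> g n 1"
    using gcoef_off_diag_bounds(1)[of 1 n] kernel_le_gcoef_diag[of n] assms by (cases "n = 1") auto
  finally show ?thesis .
qed

lemma gcoef_pos:
  assumes "1 \<le> j" "j \<le> n" "n \<le> N"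
  shows "0 < g n j"
proof -
  have "0 < T powr (- \<alpha>) / G"
    using T G_pos by simp
  also have "\<dots> \<le> g n 1"
    using gcoef_first_ge assms by simp
  also have "g n 1 \<le> g n j"
    using assms(1,2)
  proof (induction j rule: dec_induct)
    case (step i)
    then show ?case
      using gcoef_mono[of i n] by simp
  qed simp
  finally show ?thesis .
qed

end

section \<open>Bilinear forms and nonlocal problems\<close>

lemma sq_le_mult_if_young:
  fixes p q s :: real
  assumes young: "\<And>c d. 2 * c * d * p \<le> c\<^sup>2 * q + d\<^sup>2 * s" and "0 \<le> s"
  shows "p\<^sup>2 \<le> q * s"
proof (cases "s = 0")
  case True
  have "p = 0"
  proof (rule ccontr)
    assume p: "p \<noteq> 0"
    \<comment> \<open>For \<open>s = 0\<close> the right-hand side stays at \<open>q\<close>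
      whatever \<open>d\<close> is; this \<open>d\<close> raises the left-hand side to
      \<open>q + 1\<close>.\<close>
    have "2 * 1 * ((q + 1) / (2 * p)) * p \<le> 1\<^sup>2 * q + ((q + 1) / (2 * p))\<^sup>2 * 0"
      using young[of 1 "(q + 1) / (2 * p)"] unfolding True .
    moreover have "2 * 1 * ((q + 1) / (2 * p)) * p = q + 1"
      using p by (simp add: divide_simps)
    ultimately show False
      by simp
  qed
  then show ?thesis
    using True by simp
next
  case False
  then have "0 < s"
    using assms(2) by simp
  \<comment> \<open>The choice \<open>c = s\<close>, \<open>d = p\<close> leaves one factor
    \<open>s\<close> to cancel.\<close>
  moreover have "s * p\<^sup>2 \<le> s * (q * s)"
    using young[of s p] by (simp add: power2_eq_square mult_ac)
  ultimately show ?thesis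
    by (rule mult_left_le_imp_le[rotated])
qed

text \<open>Definiteness is kept apart: on \<open>L2\<close> the form vanishes at functions that are
  zero almost everywhere, and the stiffness form is used as a semidefinite form. The carrier is a
  set, so that subspaces can be formed.\<close>

locale psd_form =
  fixes V :: "('a \<Rightarrow> real) set" and B :: "('a \<Rightarrow> real) \<Rightarrow> ('a \<Rightarrow> real) \<Rightarrow> real"
  assumes zero_mem: "(\<lambda>_. 0) \<in> V"
    and lin_mem: "u \<in> V \<Longrightarrow> v \<in> V \<Longrightarrow> (\<lambda>x. c * u x + d * v x) \<in> V"
    and commute: "u \<in> V \<Longrightarrow> v \<in> V \<Longrightarrow> B u v = B v u"
    and lin: "u \<in> V \<Longrightarrow> v \<in> V \<Longrightarrow> w \<in> V \<Longrightarrow> B (\<lambda>x. c * u x + d * v x) w = c * B u w + d * B v w"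
    and nonneg: "u \<in> V \<Longrightarrow> 0 \<le> B u u"
begin

lemma lin_right:
  "u \<in> V \<Longrightarrow> v \<in> V \<Longrightarrow> w \<in> V \<Longrightarrow> B w (\<lambda>x. c * u x + d * v x) = c * B w u + d * B w v"
  by (simp only: commute[of w] lin_mem lin)

lemma diff_mem: "u \<in> V \<Longrightarrow> v \<in> V \<Longrightarrow> (\<lambda>x. u x - v x) \<in> V"
  using lin_mem[of u v 1 "-1"] by simp

lemma diff_left: "u \<in> V \<Longrightarrow> v \<in> V \<Longrightarrow> w \<in> V \<Longrightarrow> B (\<lambda>x. u x - v x) w = B u w - B v w"
  using lin[of u v w 1 "-1"] by simp

lemma zero_right: "w \<in> V \<Longrightarrow> B w (\<lambda>_. 0) = 0"
  using lin_right[OF zero_mem zero_mem, of w 0 0] by simp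

lemma sum_mem: "(\<And>j. j \<in> J \<Longrightarrow> u j \<in> V) \<Longrightarrow> (\<lambda>x. \<Sum>j\<in>J. c j * u j x) \<in> V"
proof (induction J rule: infinite_finite_induct)
  case (insert i J)
  then show ?case
    using lin_mem[of "u i" "\<lambda>x. \<Sum>j\<in>J. c j * u j x" "c i" 1] by simp
qed (simp_all add: zero_mem)

lemma sum_right:
  assumes "w \<in> V" "\<And>j. j \<in> J \<Longrightarrow> u j \<in> V"
  shows "B w (\<lambda>x. \<Sum>j\<in>J. c j * u j x) = (\<Sum>j\<in>J. c j * B w (u j))"
  using assms(2)
proof (induction J rule: infinite_finite_induct)
  case (insert i J)
  then show ?case
    using lin_right[of "u i" "\<lambda>x. \<Sum>j\<in>J. c j * u j x" w "c i" 1] sum_mem[of J u c] assms(1) by simp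
qed (simp_all add: zero_right assms(1))

lemma expand:
  assumes "u \<in> V" "v \<in> V"
  shows "B (\<lambda>x. c * u x + d * v x) (\<lambda>x. c * u x + d * v x) =
    c\<^sup>2 * B u u + 2 * c * d * B u v + d\<^sup>2 * B v v"
proof -
  have "B (\<lambda>x. c * u x + d * v x) (\<lambda>x. c * u x + d * v x) =
      c * B u (\<lambda>x. c * u x + d * v x) + d * B v (\<lambda>x. c * u x + d * v x)"
    by (rule lin[OF assms lin_mem[OF assms]])
  also have "\<dots> = c * (c * B u u + d * B u v) + d * (c * B v u + d * B v v)"
    by (simp only: lin_right[OF assms assms(1)] lin_right[OF assms assms(2)])
  also have "\<dots> = c\<^sup>2 * B u u + 2 * c * d * B u v + d\<^sup>2 * B v v"
    unfolding commute[OF assms(2,1)] power2_eq_square by (simp only: algebra_simps)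
  finally show ?thesis .
qed

lemma young:
  assumes "u \<in> V" "v \<in> V"
  shows "2 * c * d * B u v \<le> c\<^sup>2 * B u u + d\<^sup>2 * B v v"
  using nonneg[OF lin_mem[OF assms, of c "-d"]] expand[OF assms, of c "-d"] by simp

lemma Cauchy_Schwarz_sq:
  assumes "u \<in> V" "v \<in> V"
  shows "(B u v)\<^sup>2 \<le> B u u * B v v"
  by (rule sq_le_mult_if_young, rule young[OF assms], rule nonneg[OF assms(2)])

lemma Cauchy_Schwarz:
  assumes "u \<in> V" "v \<in> V"
  shows "\<bar>B u v\<bar> \<le> sqrt (B u u) * sqrt (B v v)"
  using real_sqrt_le_mono[OF Cauchy_Schwarz_sq[OF assms]] by (simp add: real_sqrt_mult)

lemma subspace_psd_form:
  assumes "U \<subseteq> V" "(\<lambda>_. 0) \<in> U"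
    and "\<And>u v c d. u \<in> U \<Longrightarrow> v \<in> U \<Longrightarrow> (\<lambda>x. c * u x + d * v x) \<in> U"
  shows "psd_form U B"
proof
  show "(\<lambda>_. 0) \<in> U"
    by (rule assms(2))
next
  fix u v c d
  assume "u \<in> U" "v \<in> U"
  then show "(\<lambda>x. c * u x + d * v x) \<in> U"
    by (rule assms(3))
next
  fix u v
  assume "u \<in> U" "v \<in> U"
  then show "B u v = B v u"
    using assms(1) commute by blast
next
  fix u v w c d
  assume "u \<in> U" "v \<in> U" "w \<in> U"
  then show "B (\<lambda>x. c * u x + d * v x) w = c * B u w + d * B v w"
    using assms(1) by (intro lin) auto
next
  fix u
  assume "u \<in> U"
  then show "0 \<le> B u u"
    using assms(1) nonneg by blast
qed

end

locale pd_form = psd_form +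
  assumes definite: "u \<in> V \<Longrightarrow> B u u = 0 \<Longrightarrow> u = (\<lambda>_. 0)"

section \<open>Riesz representation in finite dimension\<close>

definition linear_form_on :: "('a \<Rightarrow> real) set \<Rightarrow> (('a \<Rightarrow> real) \<Rightarrow> real) \<Rightarrow> bool" where
  "linear_form_on V F \<longleftrightarrow>
     (\<forall>u\<in>V. \<forall>v\<in>V. \<forall>c d. F (\<lambda>x. c * u x + d * v x) = c * F u + d * F v)"

lemma linear_form_onD:
  "linear_form_on V F \<Longrightarrow> u \<in> V \<Longrightarrow> v \<in> V \<Longrightarrow> F (\<lambda>x. c * u x + d * v x) = c * F u + d * F v"
  by (auto simp: linear_form_on_def)

lemma linear_form_on_diff:
  "linear_form_on V F \<Longrightarrow> u \<in> V \<Longrightarrow> v \<in> V \<Longrightarrow> F (\<lambda>x. u x - v x) = F u - F v"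
  using linear_form_onD[of V F u v 1 "-1"] by simp

text \<open>A finite set \<open>P\<close> on which the functions of \<open>V\<close> are determined by their values
  replaces a basis. The induction removes a point \<open>p\<close> from \<open>P\<close> and passes to the
  subspace of functions that vanish at \<open>p\<close>.\<close>

lemma Riesz_determined_by_points:
  assumes "finite P" "pd_form V B" "linear_form_on V F"
    and "\<And>v. v \<in> V \<Longrightarrow> (\<And>p. p \<in> P \<Longrightarrow> v p = 0) \<Longrightarrow> v = (\<lambda>_. 0)"
  shows "\<exists>w\<in>V. \<forall>v\<in>V. B w v = F v"
  using assms
proof (induction P arbitrary: V F rule: finite_induct)
  case empty
  interpret pd_form V B
    by (rule empty.prems(1))
  have "F (\<lambda>_. 0) = 0"
    using linear_form_onD[OF empty.prems(2) zero_mem zero_mem, of 0 0] by simp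
  have "B (\<lambda>_. 0) v = F v" if "v \<in> V" for v
  proof -
    have "v = (\<lambda>_. 0)"
      using that by (rule empty.prems(3)) simp
    then show ?thesis
      using \<open>F (\<lambda>_. 0) = 0\<close> zero_right[OF zero_mem] by simp
  qed
  then show ?case
    using zero_mem by (intro bexI[of _ "\<lambda>_. 0"]) auto
next
  case (insert p P)
  interpret pd_form V B
    by (rule insert.prems(1))
  define V' where "V' = {v \<in> V. v p = 0}"
  have sub: "V' \<subseteq> V"
    by (auto simp: V'_def)
  interpret V': pd_form V' B
  proof -
    have "psd_form V' B"
      by (rule subspace_psd_form[OF sub]) (auto simp: V'_def zero_mem lin_mem)
    then show "pd_form V' B"
      using definite sub by (auto simp: pd_form_def pd_form_axioms_def)
  qed
  have ex: "\<exists>w\<in>V'. \<forall>v\<in>V'. B w v = G v" if "linear_form_on V' G" for G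
    using insert.IH[OF V'.pd_form_axioms that] insert.prems(3) by (auto simp: V'_def)
  show ?case
  proof (cases "V' = V")
    case True
    then show ?thesis
      using ex insert.prems(2) by simp
  next
    case False
    then obtain e where e: "e \<in> V" "e p \<noteq> 0"
      by (auto simp: V'_def)
    have "linear_form_on V' (B e)"
      using e lin_right sub by (auto simp: linear_form_on_def subset_iff)
    then obtain e1 where e1: "e1 \<in> V'" "\<forall>v\<in>V'. B e1 v = B e v"
      using ex by blast
    \<comment> \<open>\<open>k\<close> is \<open>e\<close> minus its \<open>B\<close>-orthogonal
      projection onto \<open>V'\<close>; it spans the orthogonal complement of \<open>V'\<close> in
      \<open>V\<close>.\<close>
    define k where "k = (\<lambda>x. e x - e1 x)"
    have k: "k \<in> V" "k p \<noteq> 0"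
      using e e1 sub diff_mem by (auto simp: k_def V'_def)
    have orth: "B k v = 0" if "v \<in> V'" for v
      using that e e1 sub diff_left by (auto simp: k_def subset_iff)
    have kk: "B k k \<noteq> 0"
      using definite k by force
    have "linear_form_on V' F"
      using insert.prems(2) sub by (auto simp: linear_form_on_def subset_iff)
    then obtain w1 where w1: "w1 \<in> V'" "\<forall>v\<in>V'. B w1 v = F v"
      using ex by blast
    \<comment> \<open>\<open>w1\<close> represents \<open>F\<close> on \<open>V'\<close>, and the
      coefficient of \<open>k\<close> is the one that gives the right value at
      \<open>k\<close>.\<close>
    define w where "w = (\<lambda>x. 1 * w1 x + F k / B k k * k x)"
    have "w \<in> V"
      unfolding w_def using w1 k sub lin_mem by blast
    moreover have "B w v = F v" if v: "v \<in> V" for v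
    proof -
      \<comment> \<open>\<open>V'\<close> is the kernel of evaluation at \<open>p\<close>, so the
        values at \<open>p\<close> determine the component of \<open>v\<close> along
        \<open>k\<close>.\<close>
      define v1 where "v1 = (\<lambda>x. v x - v p / k p * k x)"
      have v1: "v1 \<in> V'"
        using k v lin_mem[OF v k(1), of 1 "- (v p / k p)"] by (simp add: v1_def V'_def)
      have veq: "v = (\<lambda>x. 1 * v1 x + v p / k p * k x)"
        by (simp add: v1_def)
      have v1V: "v1 \<in> V" and w1V: "w1 \<in> V"
        using v1 w1 sub by auto
      have "B w v = 1 * B w1 v + F k / B k k * B k v"
        unfolding w_def by (rule lin[OF w1V k(1) v])
      moreover have "B w1 v = F v1"
        using lin_right[OF v1V k(1) w1V, of 1 "v p / k p"] w1 v1 orth[OF w1(1)]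
          commute[OF w1V k(1)] veq by simp
      moreover have "B k v = v p / k p * B k k"
        using lin_right[OF v1V k(1) k(1), of 1 "v p / k p"] orth[OF v1] veq by simp
      moreover have "F v = F v1 + v p / k p * F k"
        using linear_form_onD[OF insert.prems(2) v1V k(1), of 1 "v p / k p"] veq by simp
      ultimately show ?thesis
        using kk by simp
    qed
    ultimately show ?thesis
      by blast
  qed
qed

section \<open>Summation by parts and discrete fractional inequalities\<close>

lemma sum_increments_by_parts:
  fixes g y :: "nat \<Rightarrow> real"
  defines "c \<equiv> \<lambda>j. g (Suc j) - (if j = 0 then 0 else g j)"
  shows "(\<Sum>j=1..n. g j * (y j - y (j - 1))) = (\<Sum>j<n. c j * (y n - y j))"
    and "(\<Sum>j<n. c j) = (if n = 0 then 0 else g n)"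
proof -
  show c: "(\<Sum>j<n. c j) = (if n = 0 then 0 else g n)" for n
    by (induction n) (auto simp: c_def)
  show "(\<Sum>j=1..n. g j * (y j - y (j - 1))) = (\<Sum>j<n. c j * (y n - y j))"
  proof (induction n)
    case (Suc n)
    have "(\<Sum>j<Suc n. c j * (y (Suc n) - y j)) =
        (\<Sum>j<Suc n. c j * (y (Suc n) - y n) + c j * (y n - y j))"
      by (intro sum.cong) (auto simp: algebra_simps)
    also have "\<dots> = (\<Sum>j<Suc n. c j) * (y (Suc n) - y n) + (\<Sum>j<Suc n. c j * (y n - y j))"
      by (simp only: sum.distrib sum_distrib_right)
    also have "\<dots> = g (Suc n) * (y (Suc n) - y n) + (\<Sum>j<n. c j * (y n - y j))"
      unfolding c by simp
    finally show ?case
      using Suc by simp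
  qed simp
qed

text \<open>A discrete maximum principle. If all earlier values are at most
  \<open>Y = y 0 + K / \<gamma>\<close> and \<open>y n\<close> exceeds \<open>Y\<close>, then after
  summation by parts every term is nonnegative, and the term with \<open>y 0\<close> alone is larger
  than \<open>K\<close>.\<close>

lemma discrete_fractional_comparison:
  fixes g :: "nat \<Rightarrow> nat \<Rightarrow> real" and y :: "nat \<Rightarrow> real"
  assumes mono: "\<And>n j. n \<le> m \<Longrightarrow> 1 \<le> j \<Longrightarrow> j < n \<Longrightarrow> g n j \<le> g n (Suc j)"
    and first: "\<And>n. 1 \<le> n \<Longrightarrow> n \<le> m \<Longrightarrow> \<gamma> \<le> g n 1" and "0 < \<gamma>" "0 \<le> K"
    and bound: "\<And>n. 1 \<le> n \<Longrightarrow> n \<le> m \<Longrightarrow> (\<Sum>j=1..n. g n j * (y j - y (j - 1))) \<le> K"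
  shows "n \<le> m \<Longrightarrow> y n \<le> y 0 + K / \<gamma>"
proof (induction n rule: less_induct)
  case (less n)
  show ?case
  proof (cases "n = 0")
    case True
    then show ?thesis
      using \<open>0 < \<gamma>\<close> \<open>0 \<le> K\<close> by simp
  next
    case False
    define c where "c = (\<lambda>j. g n (Suc j) - (if j = 0 then 0 else g n j))"
    define Y where "Y = y 0 + K / \<gamma>"
    have c: "0 \<le> c j" if "j < n" for j
      using that mono[of n j] first[of n] less.prems \<open>0 < \<gamma>\<close> by (cases "j = 0") (auto simp: c_def)
    show ?thesis
    proof (rule ccontr)
      assume "\<not> ?thesis"
      then have gt: "Y < y n"
        by (simp add: Y_def)
      have "K = \<gamma> * (K / \<gamma>)"
        using \<open>0 < \<gamma>\<close> by simp
      also have "\<dots> < \<gamma> * (y n - y 0)"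
        using gt \<open>0 < \<gamma>\<close> by (intro mult_strict_left_mono) (auto simp: Y_def)
      also have "\<dots> \<le> c 0 * (y n - y 0)"
        using first[of n] False less.prems gt divide_nonneg_pos[OF \<open>0 \<le> K\<close> \<open>0 < \<gamma>\<close>]
        unfolding c_def Y_def by (intro mult_right_mono) simp_all
      also have "\<dots> \<le> (\<Sum>j<n. c j * (y n - y j))"
      proof (rule member_le_sum)
        fix j
        assume "j \<in> {..<n} - {0}"
        then show "0 \<le> c j * (y n - y j)"
          using less.IH[of j] less.prems gt c[of j] by (auto simp: Y_def)
      qed (use False in auto)
      also have "\<dots> = (\<Sum>j=1..n. g n j * (y j - y (j - 1)))"
        unfolding c_def by (rule sum_increments_by_parts(1)[symmetric])
      also have "\<dots> \<le> K"
        using bound False less.prems by simp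
      finally show False
        by simp
    qed
  qed
qed

text \<open>Summation by parts turns the difference of the two sides into
  \<open>\<Sum>j<n. c j * (B (e j) (e j) / 2 - \<sigma> * B (e (n - 1)) (e j))\<close> with
  \<open>e j = u n - u j\<close> and \<open>c j \<ge> 0\<close>; the last summand absorbs the others.\<close>

lemma (in psd_form) increments_inner_ge:
  fixes g :: "nat \<Rightarrow> real" and u :: "nat \<Rightarrow> 'a \<Rightarrow> real" and \<sigma> :: real
  assumes "1 \<le> n" and u: "\<And>j. j \<le> n \<Longrightarrow> u j \<in> V"
    and mono: "\<And>j. 1 \<le> j \<Longrightarrow> j < n \<Longrightarrow> g j \<le> g (Suc j)" and first: "0 \<le> g 1"
    and dom: "2 \<le> n \<Longrightarrow> (1 - \<sigma>)\<^sup>2 * g (n - 1) \<le> (1 - 2 * \<sigma>) * g n" and \<sigma>: "\<sigma> \<le> 1 / 2"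
  shows "(\<Sum>j=1..n. g j * (B (u j) (u j) - B (u (j - 1)) (u (j - 1)))) \<le>
    2 * B (\<lambda>x. (1 - \<sigma>) * u n x + \<sigma> * u (n - 1) x) (\<lambda>x. \<Sum>j=1..n. g j * (u j x - u (j - 1) x))"
proof -
  obtain m where n: "n = Suc m"
    using assms(1) by (cases n) auto
  define c where "c = (\<lambda>j. g (Suc j) - (if j = 0 then 0 else g j))"
  define e where "e = (\<lambda>j x. u n x - u j x)"
  have e: "e j \<in> V" if "j \<le> n" for j
    unfolding e_def using u that by (intro diff_mem) auto
  have un: "u n \<in> V" and em: "e m \<in> V"
    using u e n by auto
  define q where "q = B (e m) (e m)"
  have c: "0 \<le> c j" if "j < n" for j
    using that mono[of j] first by (cases "j = 0") (auto simp: c_def)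
  have W: "(\<lambda>x. (1 - \<sigma>) * u n x + \<sigma> * u (n - 1) x) = (\<lambda>x. 1 * u n x + (- \<sigma>) * e m x)"
    by (rule ext) (simp add: e_def n algebra_simps)
  have D: "(\<lambda>x. \<Sum>j=1..n. g j * (u j x - u (j - 1) x)) = (\<lambda>x. \<Sum>j<n. c j * e j x)"
    unfolding c_def e_def by (rule ext) (rule sum_increments_by_parts(1))
  have BW: "B (\<lambda>x. 1 * u n x + (- \<sigma>) * e m x) (e j) = B (u n) (e j) - \<sigma> * B (e m) (e j)"
    if "j < n" for j
    using lin[OF un em e, of j 1 "- \<sigma>"] that by simp
  have uj: "B (u j) (u j) = B (u n) (u n) - 2 * B (u n) (e j) + B (e j) (e j)" if "j < n" for j
    using expand[OF un e, of j 1 "- 1"] that by (simp add: e_def)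
  have "2 * B (\<lambda>x. (1 - \<sigma>) * u n x + \<sigma> * u (n - 1) x)
          (\<lambda>x. \<Sum>j=1..n. g j * (u j x - u (j - 1) x)) =
      (\<Sum>j<n. c j * (2 * B (u n) (e j) - 2 * \<sigma> * B (e m) (e j)))"
    unfolding W D
  proof (subst sum_right)
    show "(\<lambda>x. 1 * u n x + (- \<sigma>) * e m x) \<in> V"
      by (rule lin_mem[OF un em])
    show "2 * (\<Sum>j<n. c j * B (\<lambda>x. 1 * u n x + (- \<sigma>) * e m x) (e j)) =
        (\<Sum>j<n. c j * (2 * B (u n) (e j) - 2 * \<sigma> * B (e m) (e j)))"
      unfolding sum_distrib_left
      by (intro sum.cong refl) (subst BW, auto simp: algebra_simps)
  qed (use e in auto)
  moreover have "(\<Sum>j=1..n. g j * (B (u j) (u j) - B (u (j - 1)) (u (j - 1)))) =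
      (\<Sum>j<n. c j * (2 * B (u n) (e j) - B (e j) (e j)))"
  proof -
    have "(\<Sum>j=1..n. g j * (B (u j) (u j) - B (u (j - 1)) (u (j - 1)))) =
        (\<Sum>j<n. c j * (B (u n) (u n) - B (u j) (u j)))"
      unfolding c_def by (rule sum_increments_by_parts(1))
    also have "\<dots> = (\<Sum>j<n. c j * (2 * B (u n) (e j) - B (e j) (e j)))"
      by (intro sum.cong refl) (simp add: uj)
    finally show ?thesis .
  qed
  \<comment> \<open>The summand \<open>j = m\<close> is exact and yields
    \<open>(1 - 2 * \<sigma>) * c m * q\<close>; in each of the others Young's inequality costs
    \<open>c j * (\<sigma>\<^sup>2 * q)\<close>.\<close>
  moreover have "(\<Sum>j<n. c j * (2 * B (u n) (e j) - B (e j) (e j))) + (1 - 2 * \<sigma>) * c m * q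
        - \<sigma>\<^sup>2 * q * (\<Sum>j<m. c j) \<le>
      (\<Sum>j<n. c j * (2 * B (u n) (e j) - 2 * \<sigma> * B (e m) (e j)))"
  proof -
    have "(\<Sum>j<m. c j * (2 * B (u n) (e j) - B (e j) (e j)) - c j * (\<sigma>\<^sup>2 * q)) \<le>
        (\<Sum>j<m. c j * (2 * B (u n) (e j) - 2 * \<sigma> * B (e m) (e j)))"
    proof (rule sum_mono)
      fix j
      assume "j \<in> {..<m}"
      then have j: "j < n" "e j \<in> V"
        using e n by auto
      have "2 * B (u n) (e j) - B (e j) (e j) - \<sigma>\<^sup>2 * q \<le>
          2 * B (u n) (e j) - 2 * \<sigma> * B (e m) (e j)"
        using young[OF em j(2), of \<sigma> 1] by (simp add: q_def)
      from mult_left_mono[OF this c[OF j(1)]]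
      show "c j * (2 * B (u n) (e j) - B (e j) (e j)) - c j * (\<sigma>\<^sup>2 * q) \<le>
          c j * (2 * B (u n) (e j) - 2 * \<sigma> * B (e m) (e j))"
        by (simp add: right_diff_distrib)
    qed
    then show ?thesis
      unfolding n sum.lessThan_Suc sum_subtractf sum_distrib_right[symmetric] q_def
      by (simp add: algebra_simps)
  qed
  \<comment> \<open>For \<open>m > 0\<close> the coefficients below \<open>m\<close> telescope to
    \<open>g m\<close>, and since \<open>c m = g n - g m\<close>, the claim without the factor
    \<open>q\<close> is a rearrangement of \<open>dom\<close>.\<close>
  moreover have "0 \<le> (1 - 2 * \<sigma>) * c m * q - \<sigma>\<^sup>2 * q * (\<Sum>j<m. c j)"
  proof -
    have q: "0 \<le> q"
      unfolding q_def by (rule nonneg[OF em])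
    have "0 \<le> (1 - 2 * \<sigma>) * c m - \<sigma>\<^sup>2 * (\<Sum>j<m. c j)"
    proof (cases "m = 0")
      case True
      then show ?thesis
        using \<sigma> first by (simp add: c_def)
    next
      case False
      have "(\<Sum>j<m. c j) = g m"
        using sum_increments_by_parts(2)[of g m] False by (simp add: c_def)
      then show ?thesis
        using dom False by (simp add: c_def n power2_eq_square algebra_simps)
    qed
    from mult_nonneg_nonneg[OF this q] show ?thesis
      by (simp add: algebra_simps)
  qed
  ultimately show ?thesis
    by linarith
qed

section \<open>The nonlocal problem: existence, and uniqueness under a smallness condition\<close>

locale nonlocal_problem =
  M: pd_form V M + A: psd_form V A for V :: "('a \<Rightarrow> real) set" and M A +
  fixes P :: "'a set" and a :: "real \<Rightarrow> real" and l :: "('a \<Rightarrow> real) \<Rightarrow> real" and m1 L k c :: real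
  assumes finite_P: "finite P"
    and determined: "\<And>v. v \<in> V \<Longrightarrow> (\<And>p. p \<in> P \<Longrightarrow> v p = 0) \<Longrightarrow> v = (\<lambda>_. 0)"
    and m1: "0 < m1" and a_ge: "\<And>x. m1 \<le> a x"
    and a_lip: "\<And>x y. \<bar>a x - a y\<bar> \<le> L * \<bar>x - y\<bar>"
    and l_lin: "linear_form_on V l"
    and k: "0 \<le> k" and l_bound: "\<And>v. v \<in> V \<Longrightarrow> \<bar>l v\<bar> \<le> k * sqrt (M v v)"
    and c: "0 < c"
begin

lemma L_nonneg: "0 \<le> L"
  using a_lip[of 1 0] by simp

lemma perturbation_bound:
  assumes "u \<in> V" "v \<in> V" "m1 \<le> p"
    and eqs: "\<And>w. w \<in> V \<Longrightarrow> c * M u w + p * A u w = c * M v w + q * A v w"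
  defines "E \<equiv> \<lambda>x. u x - v x"
  shows "4 * m1 * c * M E E \<le> (q - p)\<^sup>2 * A v v"
proof -
  have E: "E \<in> V"
    unfolding E_def using assms(1,2) by (rule M.diff_mem)
  have "M u E = M v E + M E E" "A u E = A v E + A E E"
    using M.diff_left[OF assms(1,2) E] A.diff_left[OF assms(1,2) E] by (simp_all add: E_def)
  then have "c * M E E + p * A E E = (q - p) * A v E"
    using eqs[OF E] by (simp add: algebra_simps)
  moreover have "m1 * A E E \<le> p * A E E"
    using assms(3) A.nonneg[OF E] by (rule mult_right_mono)
  ultimately have "4 * m1 * (c * M E E) \<le> 4 * m1 * ((q - p) * A v E - m1 * A E E)"
    using m1 by (intro mult_left_mono) auto
  \<comment> \<open>The weight \<open>2 * m1\<close> makes the Young term in \<open>A E E\<close>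
    cancel exactly.\<close>
  also have "\<dots> \<le> (q - p)\<^sup>2 * A v v"
    using A.young[OF assms(2) E, of "q - p" "2 * m1"]
    by (simp add: power2_eq_square algebra_simps)
  finally show ?thesis
    by (simp add: mult.assoc)
qed

lemma frozen_exists:
  assumes "linear_form_on V F"
  shows "\<exists>w\<in>V. \<forall>v\<in>V. c * M w v + a s * A w v = F v"
proof -
  have as: "0 < a s"
    using a_ge[of s] m1 by simp
  have "pd_form V (\<lambda>u v. c * M u v + a s * A u v)"
  proof
    fix u v w :: "'a \<Rightarrow> real" and b d :: real
    assume V: "u \<in> V" "v \<in> V" "w \<in> V"
    show "c * M (\<lambda>x. b * u x + d * v x) w + a s * A (\<lambda>x. b * u x + d * v x) w =
        b * (c * M u w + a s * A u w) + d * (c * M v w + a s * A v w)"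
      unfolding M.lin[OF V] A.lin[OF V] by (simp add: algebra_simps)
  next
    fix u
    assume "u \<in> V" "c * M u u + a s * A u u = 0"
    moreover have "0 \<le> a s * A u u"
      using as A.nonneg[OF \<open>u \<in> V\<close>] by simp
    ultimately have "c * M u u \<le> 0"
      by linarith
    then have "M u u = 0"
      using c M.nonneg[OF \<open>u \<in> V\<close>] by (simp add: mult_le_0_iff)
    then show "u = (\<lambda>_. 0)"
      using M.definite[OF \<open>u \<in> V\<close>] by simp
  next
    fix u v :: "'a \<Rightarrow> real"
    assume "u \<in> V" "v \<in> V"
    then show "c * M u v + a s * A u v = c * M v u + a s * A v u"
      using M.commute[of u v] A.commute[of u v] by (simp only:)
  next
    fix u :: "'a \<Rightarrow> real"
    assume "u \<in> V"
    then show "0 \<le> c * M u u + a s * A u u"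
      using M.nonneg[of u] A.nonneg[of u] c as by simp
  qed (simp_all add: M.zero_mem M.lin_mem)
  from Riesz_determined_by_points[OF finite_P this assms determined] show ?thesis .
qed

theorem exists_solution:
  assumes "linear_form_on V F"
  shows "\<exists>w\<in>V. \<forall>v\<in>V. c * M w v + a (l w) * A w v = F v"
proof -
  obtain W where W: "\<And>s. W s \<in> V" "\<And>s v. v \<in> V \<Longrightarrow> c * M (W s) v + a s * A (W s) v = F v"
    using frozen_exists[OF assms] by metis
  \<comment> \<open>\<open>z\<close> represents \<open>F\<close> in the form \<open>M\<close>.
    Testing with \<open>W s\<close> then bounds \<open>W s\<close> through \<open>z\<close>,
    uniformly in \<open>s\<close>.\<close>
  obtain z where z: "z \<in> V" "\<And>v. v \<in> V \<Longrightarrow> M z v = F v"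
    using Riesz_determined_by_points[OF finite_P M.pd_form_axioms assms determined] by metis
  define R where "R = k * (sqrt (M z z) / c)"
  have bound: "\<bar>l (W s)\<bar> \<le> R" for s
  proof -
    let ?q = "sqrt (M (W s) (W s))"
    have q: "0 \<le> ?q" "?q * ?q = M (W s) (W s)"
      using M.nonneg[OF W(1)] by auto
    have "c * (?q * ?q) + a s * A (W s) (W s) = M z (W s)"
      using W z q by simp
    moreover have "0 \<le> a s * A (W s) (W s)"
      using A.nonneg[OF W(1)] a_ge[of s] m1 by simp
    moreover have "M z (W s) \<le> sqrt (M z z) * ?q"
      using M.Cauchy_Schwarz[OF z(1) W(1)[of s]] by linarith
    ultimately have "?q * (c * ?q) \<le> ?q * sqrt (M z z)"
      by (simp add: mult_ac)
    then have "c * ?q \<le> sqrt (M z z)"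
      using q(1) M.nonneg[OF z(1)] by (cases "?q = 0") (auto simp: mult_le_cancel_left)
    then have "?q \<le> sqrt (M z z) / c"
      using c by (simp add: pos_le_divide_eq mult.commute)
    then show ?thesis
      using l_bound[OF W(1)[of s]] mult_left_mono[OF _ k] unfolding R_def by (meson order_trans)
  qed
  have "isCont (\<lambda>s. l (W s)) s0" for s0
  proof -
    \<comment> \<open>The perturbation bound involves the energy of only one of the two solutions,
      so the constant can be taken at \<open>s0\<close>, independently of \<open>s\<close>.\<close>
    define C where "C = k * (sqrt (A (W s0) (W s0) / (4 * m1 * c)) * L)"
    have lip: "\<bar>l (W s) - l (W s0)\<bar> \<le> C * \<bar>s - s0\<bar>" for s
    proof -
      define E where "E = (\<lambda>x. W s x - W s0 x)"
      have E: "E \<in> V"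
        unfolding E_def using W(1) M.diff_mem by blast
      have "4 * m1 * c * M E E \<le> (a s0 - a s)\<^sup>2 * A (W s0) (W s0)"
        unfolding E_def using W by (intro perturbation_bound a_ge) auto
      also have "\<dots> \<le> (L * \<bar>s - s0\<bar>)\<^sup>2 * A (W s0) (W s0)"
        using a_lip[of s0 s] A.nonneg[OF W(1)] L_nonneg
        by (intro mult_right_mono abs_le_square_iff[THEN iffD1])
          (auto simp: abs_minus_commute abs_mult)
      finally have "M E E \<le> A (W s0) (W s0) / (4 * m1 * c) * (L * \<bar>s - s0\<bar>)\<^sup>2"
        using m1 c by (simp add: pos_le_divide_eq mult_ac)
      from real_sqrt_le_mono[OF this]
      have "sqrt (M E E) \<le> sqrt (A (W s0) (W s0) / (4 * m1 * c)) * (L * \<bar>s - s0\<bar>)"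
        using L_nonneg by (simp only: real_sqrt_mult real_sqrt_abs abs_mult abs_of_nonneg abs_idempotent)
      then have "k * sqrt (M E E) \<le> C * \<bar>s - s0\<bar>"
        unfolding C_def mult.assoc by (rule mult_left_mono[OF _ k])
      then show ?thesis
        using l_bound[OF E] linear_form_on_diff[OF l_lin W(1) W(1), of s s0] by (simp add: E_def)
    qed
    have "((\<lambda>s. l (W s) - l (W s0)) \<longlongrightarrow> 0) (at s0)"
    proof (rule Lim_null_comparison)
      show "\<forall>\<^sub>F s in at s0. norm (l (W s) - l (W s0)) \<le> C * \<bar>s - s0\<bar>"
        using lip by simp
      show "((\<lambda>s. C * \<bar>s - s0\<bar>) \<longlongrightarrow> 0) (at s0)"
        by (auto intro!: tendsto_eq_intros)
    qed
    then show ?thesis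
      unfolding isCont_def by (rule LIM_zero_cancel)
  qed
  \<comment> \<open>As \<open>R\<close> bounds \<open>l (W s)\<close> for every \<open>s\<close>,
    the function \<open>s - l (W s)\<close> changes sign on this interval.\<close>
  then have "continuous_on {- R..R} (\<lambda>s. s - l (W s))"
    by (intro continuous_intros continuous_at_imp_continuous_on) auto
  moreover have "- R - l (W (- R)) \<le> 0" "0 \<le> R - l (W R)" "- R \<le> R"
    using bound[of "- R"] bound[of R] by auto
  ultimately obtain s where "s - l (W s) = 0"
    using IVT'[of "\<lambda>s. s - l (W s)" "- R" 0 R] by blast
  then have "l (W s) = s"
    by simp
  then show ?thesis
    using W(1)[of s] W(2)[where s = s] by (intro bexI[of _ "W s"]) auto
qed

text \<open>The two coefficients differ by at most \<open>L * k * sqrt (M E E)\<close>, so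
  \<open>M E E\<close> appears on both sides of the perturbation bound. Smallness is required of one
  solution only.\<close>

theorem unique_solution:
  assumes "u \<in> V" "v \<in> V"
    and "\<And>w. w \<in> V \<Longrightarrow> c * M u w + a (l u) * A u w = F w"
    and "\<And>w. w \<in> V \<Longrightarrow> c * M v w + a (l v) * A v w = F w"
    and small: "(L * k)\<^sup>2 * A v v < 4 * m1 * c"
  shows "u = v"
proof -
  define E where "E = (\<lambda>x. u x - v x)"
  have E: "E \<in> V"
    unfolding E_def using assms(1,2) by (rule M.diff_mem)
  have "\<bar>a (l v) - a (l u)\<bar> \<le> L * \<bar>l E\<bar>"
    using a_lip[of "l v" "l u"] linear_form_on_diff[OF l_lin assms(1,2)]
    by (simp add: E_def abs_minus_commute)
  also have "\<dots> \<le> L * (k * sqrt (M E E))"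
    using l_bound[OF E] L_nonneg by (intro mult_left_mono)
  finally have "\<bar>a (l v) - a (l u)\<bar> \<le> \<bar>L * k * sqrt (M E E)\<bar>"
    by (simp add: mult.assoc)
  then have "(a (l v) - a (l u))\<^sup>2 \<le> (L * k * sqrt (M E E))\<^sup>2"
    by (simp only: abs_le_square_iff)
  also have "\<dots> = (L * k)\<^sup>2 * M E E"
    using M.nonneg[OF E] by (simp add: power_mult_distrib)
  finally have sq: "(a (l v) - a (l u))\<^sup>2 \<le> (L * k)\<^sup>2 * M E E" .
  have "4 * m1 * c * M E E \<le> (a (l v) - a (l u))\<^sup>2 * A v v"
    unfolding E_def using assms by (intro perturbation_bound a_ge) auto
  also have "\<dots> \<le> (L * k)\<^sup>2 * M E E * A v v"
    using sq A.nonneg[OF assms(2)] by (rule mult_right_mono)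
  finally have "(4 * m1 * c - (L * k)\<^sup>2 * A v v) * M E E \<le> 0"
    by (simp add: algebra_simps)
  then have "M E E = 0"
    using small M.nonneg[OF E] by (simp add: mult_le_0_iff)
  then have "E = (\<lambda>_. 0)"
    using M.definite[OF E] by simp
  then show ?thesis
    by (simp add: E_def fun_eq_iff)
qed

end

section \<open>The finite element space\<close>

locale fe_setting =
  fixes \<Omega> :: "'a::euclidean_space set" and \<T> :: "'a set set"
  assumes open_\<Omega>: "open \<Omega>" and bounded_\<Omega>: "bounded \<Omega>"
    and finite_\<T>: "finite \<T>" and simplices: "\<And>K. K \<in> \<T> \<Longrightarrow> \<exists>C. finite C \<and> K = convex hull C"
    and \<T>_sub: "\<Union>\<T> \<subseteq> closure \<Omega>"
begin

abbreviation "V \<equiv> fe_space \<T>"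

text \<open>This null set also contains the boundary of the meshed region, where the extension by
  zero may have a kink.\<close>

definition skeleton :: "'a set" where
  "skeleton = (\<Union>K\<in>\<T>. frontier K)"

lemma \<Omega>_lmeasurable: "\<Omega> \<in> lmeasurable"
  using bounded_\<Omega> open_\<Omega> by (intro lmeasurable_open)

lemma \<Omega>_sets: "\<Omega> \<in> sets lebesgue"
  using \<Omega>_lmeasurable by (rule fmeasurableD)

sublocale finite_measure "lebesgue_on \<Omega>"
  by (rule finite_measure_lebesgue_on[OF \<Omega>_lmeasurable])

lemma closed_element: "K \<in> \<T> \<Longrightarrow> closed K"
  using simplices finite_imp_compact_convex_hull compact_imp_closed by blast

lemma skeleton_null: "skeleton \<in> null_sets lebesgue"
proof -
  have "negligible (frontier K)" if "K \<in> \<T>" for K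
    using simplices[OF that] by (auto intro: negligible_convex_frontier)
  then have "negligible skeleton"
    unfolding skeleton_def using finite_\<T> by (intro negligible_Union) auto
  then show ?thesis
    by (simp add: negligible_iff_null_sets)
qed

lemma AE_not_skeleton: "AE x in lebesgue. x \<notin> skeleton"
  by (rule AE_not_in[OF skeleton_null])

lemma AE_lebesgue_onI:
  assumes "\<And>x. x \<notin> skeleton \<Longrightarrow> Q x"
  shows "AE x in lebesgue_on \<Omega>. Q x"
  using AE_not_skeleton assms \<Omega>_sets by (simp add: AE_restrict_space_iff) (auto elim: eventually_mono)

lemma fe_continuous: "v \<in> V \<Longrightarrow> continuous_on S v"
  using continuous_on_subset by (auto simp: fe_space_def)

lemma fe_lin:
  assumes "u \<in> V" "v \<in> V"
  shows "(\<lambda>x. c * u x + d * v x) \<in> V"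
  unfolding fe_space_def
proof (intro CollectI conjI ballI allI impI)
  show "continuous_on UNIV (\<lambda>x. c * u x + d * v x)"
    using assms by (intro continuous_intros fe_continuous)
next
  fix x
  assume "x \<notin> \<Union>\<T>"
  then show "c * u x + d * v x = 0"
    using assms by (simp add: fe_space_def)
next
  fix K
  assume "K \<in> \<T>"
  then have "\<exists>p q. \<forall>x\<in>K. u x = p \<bullet> x + q" "\<exists>p q. \<forall>x\<in>K. v x = p \<bullet> x + q"
    using assms by (simp_all add: fe_space_def)
  then obtain p q p' q' where "\<forall>x\<in>K. u x = p \<bullet> x + q" "\<forall>x\<in>K. v x = p' \<bullet> x + q'"
    by blast
  then show "\<exists>p q. \<forall>x\<in>K. c * u x + d * v x = p \<bullet> x + q"
    by (intro exI[of _ "c *\<^sub>R p + d *\<^sub>R p'"] exI[of _ "c * q + d * q'"])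
      (simp add: inner_add_left algebra_simps)
qed

lemma fe_zero: "(\<lambda>_. 0) \<in> V"
  by (auto simp: fe_space_def intro!: exI[of _ 0])

text \<open>An affine function that vanishes at the vertices vanishes on their convex hull. This
  supplies the finite determining set that stands in for a basis.\<close>

lemma fe_determined_by_vertices:
  "\<exists>P. finite P \<and> (\<forall>v\<in>V. (\<forall>p\<in>P. v p = 0) \<longrightarrow> v = (\<lambda>_. 0))"
proof -
  have "\<forall>K\<in>\<T>. \<exists>C. finite C \<and> K = convex hull C"
    using simplices by blast
  from bchoice[OF this] obtain C
    where C: "\<And>K. K \<in> \<T> \<Longrightarrow> finite (C K)" "\<And>K. K \<in> \<T> \<Longrightarrow> K = convex hull (C K)"
    by blast
  have "v = (\<lambda>_. 0)" if v: "v \<in> V" and zero: "\<forall>p\<in>(\<Union>K\<in>\<T>. C K). v p = 0" for v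
  proof
    fix x
    show "v x = 0"
    proof (cases "x \<in> \<Union>\<T>")
      case True
      then obtain K where K: "K \<in> \<T>" "x \<in> K"
        by blast
      then have "\<exists>p q. \<forall>y\<in>K. v y = p \<bullet> y + q"
        using v by (simp add: fe_space_def)
      then obtain p q where pq: "\<forall>y\<in>K. v y = p \<bullet> y + q"
        by blast
      have hull: "convex hull (C K) = K"
        by (rule C(2)[OF K(1), symmetric])
      then have CK: "C K \<subseteq> K"
        using hull_subset[of "C K" convex] by (simp only:)
      have "C K \<subseteq> {y. p \<bullet> y = - q}"
      proof
        fix y
        assume y: "y \<in> C K"
        then have "v y = 0"
          using zero K(1) by blast
        moreover have "v y = p \<bullet> y + q"
          using y CK pq by blast
        ultimately show "y \<in> {y. p \<bullet> y = - q}"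
          by simp
      qed
      then have "convex hull (C K) \<subseteq> {y. p \<bullet> y = - q}"
        by (rule hull_minimal) (rule convex_hyperplane)
      then have "p \<bullet> x = - q"
        using K(2) unfolding hull by blast
      then show ?thesis
        using pq K(2) by simp
    next
      case False
      then show ?thesis
        using v by (simp add: fe_space_def)
    qed
  qed
  moreover have "finite (\<Union>K\<in>\<T>. C K)"
    using finite_\<T> C(1) by blast
  ultimately show ?thesis
    by blast
qed

lemma gradI:
  fixes u :: "'a \<Rightarrow> real"
  assumes "GDERIV u x :> D"
  shows "grad u x = D"
  unfolding grad_def
proof (rule the_equality[of "\<lambda>D. GDERIV u x :> D", OF assms])
  fix D'
  assume "GDERIV u x :> D'"
  then have "(\<lambda>h. h \<bullet> D') = (\<lambda>h. h \<bullet> D)"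
    using assms unfolding gderiv_def by (rule has_derivative_unique)
  then show "D' = D"
    by (metis vector_eq_ldot)
qed

text \<open>Finitely many values give boundedness of the gradient, local constancy gives its
  continuity off the skeleton.\<close>

lemma fe_gradient:
  assumes "v \<in> V"
  shows "\<exists>S. finite S \<and> (\<forall>x. x \<notin> skeleton \<longrightarrow>
    (\<exists>p\<in>S. \<exists>N. open N \<and> x \<in> N \<and> (\<forall>y\<in>N. GDERIV v y :> p)))"
proof -
  have "\<forall>K\<in>\<T>. \<exists>p q. \<forall>x\<in>K. v x = p \<bullet> x + q"
    using assms by (simp add: fe_space_def)
  then obtain p q where pq: "\<And>K x. K \<in> \<T> \<Longrightarrow> x \<in> K \<Longrightarrow> v x = p K \<bullet> x + q K"
    by metis
  have "\<exists>D\<in>insert 0 (p ` \<T>). \<exists>N. open N \<and> x \<in> N \<and> (\<forall>y\<in>N. GDERIV v y :> D)"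
    if x: "x \<notin> skeleton" for x
  proof (cases "x \<in> \<Union>\<T>")
    case True
    then obtain K where K: "K \<in> \<T>" "x \<in> K"
      by blast
    then have "x \<in> interior K"
      using x closed_element[OF K(1)] by (auto simp: skeleton_def frontier_def)
    moreover have "GDERIV v y :> p K" if "y \<in> interior K" for y
    proof -
      have "((\<lambda>x. p K \<bullet> x + q K) has_derivative (\<lambda>h. h \<bullet> p K)) (at y)"
        by (auto intro!: derivative_eq_intros simp: inner_commute)
      then show ?thesis
        unfolding gderiv_def
        by (rule has_derivative_transform_within_open[OF _ open_interior that])
          (use pq K(1) interior_subset in force)
    qed
    ultimately show ?thesis
      using K(1) by (intro bexI[of _ "p K"] exI[of _ "interior K"]) auto
  next
    case False
    have op: "open (- \<Union>\<T>)"
      using finite_\<T> closed_element by (intro open_Compl closed_Union) auto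
    have "GDERIV v y :> 0" if "y \<in> - \<Union>\<T>" for y
      unfolding gderiv_def
      by (rule has_derivative_transform_within_open[of "\<lambda>_. 0", OF _ op that])
        (use assms in \<open>auto simp: fe_space_def\<close>)
    then show ?thesis
      using False op by (intro bexI[of _ 0] exI[of _ "- \<Union>\<T>"]) auto
  qed
  then show ?thesis
    using finite_\<T> by (intro exI[of _ "insert 0 (p ` \<T>)"]) simp
qed

lemma fe_gderiv:
  assumes "v \<in> V" "x \<notin> skeleton"
  shows "GDERIV v x :> grad v x"
proof -
  obtain p where p: "GDERIV v x :> p"
    using fe_gradient[OF assms(1)] assms(2) by blast
  then show ?thesis
    unfolding gradI[OF p] .
qed

lemma grad_lin:
  assumes "u \<in> V" "v \<in> V" "x \<notin> skeleton"
  shows "grad (\<lambda>x. c * u x + d * v x) x = c *\<^sub>R grad u x + d *\<^sub>R grad v x"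
proof (rule gradI)
  show "GDERIV (\<lambda>x. c * u x + d * v x) x :> c *\<^sub>R grad u x + d *\<^sub>R grad v x"
    using fe_gderiv[OF assms(1,3)] fe_gderiv[OF assms(2,3)] unfolding gderiv_def
    by (auto intro!: derivative_eq_intros simp: inner_add_right)
qed

lemma grad_bounded:
  assumes "v \<in> V"
  shows "\<exists>b. \<forall>x. x \<notin> skeleton \<longrightarrow> norm (grad v x) \<le> b"
proof -
  obtain S where S: "finite S" "\<forall>x. x \<notin> skeleton \<longrightarrow>
      (\<exists>p\<in>S. \<exists>N. open N \<and> x \<in> N \<and> (\<forall>y\<in>N. GDERIV v y :> p))"
    using fe_gradient[OF assms] by blast
  have "grad v x \<in> S" if x: "x \<notin> skeleton" for x
  proof -
    obtain p where p: "p \<in> S" "GDERIV v x :> p"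
      using S(2) x by blast
    then show ?thesis
      unfolding gradI[OF p(2)] by simp
  qed
  with S(1) have "\<forall>x. x \<notin> skeleton \<longrightarrow> norm (grad v x) \<le> Max (insert 0 (norm ` S))"
    by (auto intro!: Max_ge)
  then show ?thesis
    by blast
qed

lemma grad_continuous:
  assumes "v \<in> V"
  shows "continuous_on (- skeleton) (grad v)"
proof (rule continuous_at_imp_continuous_on, rule ballI)
  fix x
  assume "x \<in> - skeleton"
  then have x: "x \<notin> skeleton"
    by simp
  obtain S where "\<forall>x. x \<notin> skeleton \<longrightarrow>
      (\<exists>p\<in>S. \<exists>N. open N \<and> x \<in> N \<and> (\<forall>y\<in>N. GDERIV v y :> p))"
    using fe_gradient[OF assms] by blast
  then obtain p N where N: "open N" "x \<in> N" "\<forall>y\<in>N. GDERIV v y :> p"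
    using x by blast
  have "\<forall>\<^sub>F y in nhds x. grad v y = p"
    using eventually_nhds_in_open[OF N(1,2)] by eventually_elim (rule gradI[OF bspec[OF N(3)]])
  then show "isCont (grad v) x"
    by (rule isCont_cong[THEN iffD2]) (rule continuous_const)
qed

text \<open>Continuity off a null set suffices because Lebesgue measure is complete.\<close>

lemma grad_inner_measurable:
  assumes "u \<in> V" "v \<in> V"
  shows "(\<lambda>x. grad u x \<bullet> grad v x) \<in> borel_measurable (lebesgue_on \<Omega>)"
proof -
  let ?h = "\<lambda>x. grad u x \<bullet> grad v x"
  have S: "- skeleton \<in> sets lebesgue"
    using null_setsD2[OF skeleton_null] by (simp add: Compl_in_sets_lebesgue)
  have "?h \<in> borel_measurable (lebesgue_on (- skeleton))"
    using S assms
    by (intro continuous_imp_measurable_on_sets_lebesgue continuous_intros grad_continuous)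
  then have "(\<lambda>x. if x \<in> - skeleton then ?h x else 0) \<in> borel_measurable lebesgue"
    by (rule borel_measurable_if_I[OF _ S])
  then have "?h \<in> borel_measurable lebesgue"
    by (rule borel_measurable_AE) (use AE_not_skeleton in \<open>auto elim: eventually_mono\<close>)
  then show ?thesis
    by (rule measurable_restrict_space1)
qed

lemma grad_inner_integrable:
  assumes "u \<in> V" "v \<in> V"
  shows "integrable (lebesgue_on \<Omega>) (\<lambda>x. grad u x \<bullet> grad v x)"
proof -
  obtain b b' where b: "\<And>x. x \<notin> skeleton \<Longrightarrow> norm (grad u x) \<le> b"
    "\<And>x. x \<notin> skeleton \<Longrightarrow> norm (grad v x) \<le> b'"
    using grad_bounded[OF assms(1)] grad_bounded[OF assms(2)] by blast
  have "AE x in lebesgue_on \<Omega>. norm (grad u x \<bullet> grad v x) \<le> b * b'"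
  proof (rule AE_lebesgue_onI)
    fix x
    assume x: "x \<notin> skeleton"
    have "norm (grad u x \<bullet> grad v x) \<le> norm (grad u x) * norm (grad v x)"
      by (simp add: Cauchy_Schwarz_ineq2)
    also have "\<dots> \<le> b * b'"
      using b[OF x] norm_ge_zero order_trans by (intro mult_mono) blast+
    finally show "norm (grad u x \<bullet> grad v x) \<le> b * b'" .
  qed
  then show ?thesis
    using grad_inner_measurable[OF assms] by (rule integrable_const_bound)
qed

text \<open>\<open>grad\<close> is linear only off the skeleton, so linearity of the form rests on
  equality almost everywhere.\<close>

sublocale stiffness: psd_form V "\<lambda>u v. L2_inner \<Omega> (grad u) (grad v)"
proof
  fix u v w :: "'a \<Rightarrow> real" and c d :: real
  assume V: "u \<in> V" "v \<in> V" "w \<in> V"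
  have "L2_inner \<Omega> (grad (\<lambda>x. c * u x + d * v x)) (grad w) =
      (LINT x|lebesgue_on \<Omega>. c * (grad u x \<bullet> grad w x) + d * (grad v x \<bullet> grad w x))"
    unfolding L2_inner_def
  proof (rule integral_cong_AE)
    show "AE x in lebesgue_on \<Omega>. grad (\<lambda>x. c * u x + d * v x) x \<bullet> grad w x =
        c * (grad u x \<bullet> grad w x) + d * (grad v x \<bullet> grad w x)"
      by (rule AE_lebesgue_onI) (simp add: grad_lin[OF V(1,2)] inner_add_left)
    show "(\<lambda>x. c * (grad u x \<bullet> grad w x) + d * (grad v x \<bullet> grad w x)) \<in>
        borel_measurable (lebesgue_on \<Omega>)"
      using V by (intro borel_measurable_add borel_measurable_times grad_inner_measurable) auto
  qed (use V in \<open>intro grad_inner_measurable fe_lin\<close>)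
  also have "\<dots> = c * L2_inner \<Omega> (grad u) (grad w) + d * L2_inner \<Omega> (grad v) (grad w)"
    unfolding L2_inner_def using V by (simp add: grad_inner_integrable)
  finally show "L2_inner \<Omega> (grad (\<lambda>x. c * u x + d * v x)) (grad w) =
      c * L2_inner \<Omega> (grad u) (grad w) + d * L2_inner \<Omega> (grad v) (grad w)" .
qed (auto simp: fe_zero fe_lin L2_inner_def inner_commute)

lemma L2_product_integrable:
  assumes "u \<in> L2 \<Omega>" "v \<in> L2 \<Omega>"
  shows "integrable (lebesgue_on \<Omega>) (\<lambda>x. u x * v x)"
proof (rule Bochner_Integration.integrable_bound)
  show "integrable (lebesgue_on \<Omega>) (\<lambda>x. (u x)\<^sup>2 + (v x)\<^sup>2)"
    using assms by (auto simp: L2_def)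
  show "(\<lambda>x. u x * v x) \<in> borel_measurable (lebesgue_on \<Omega>)"
    using assms by (auto simp: L2_def)
  have "\<bar>y * z\<bar> \<le> y\<^sup>2 + z\<^sup>2" for y z :: real
    using sum_squares_bound[of "\<bar>y\<bar>" "\<bar>z\<bar>"] mult_nonneg_nonneg[of "\<bar>y\<bar>" "\<bar>z\<bar>"]
    unfolding abs_mult power2_abs by linarith
  then show "AE x in lebesgue_on \<Omega>. norm (u x * v x) \<le> norm ((u x)\<^sup>2 + (v x)\<^sup>2)"
    by simp
qed

lemma L2_lin:
  assumes "u \<in> L2 \<Omega>" "v \<in> L2 \<Omega>"
  shows "(\<lambda>x. c * u x + d * v x) \<in> L2 \<Omega>"
proof -
  have "integrable (lebesgue_on \<Omega>) (\<lambda>x. c\<^sup>2 * (u x)\<^sup>2 + 2 * c * d * (u x * v x) + d\<^sup>2 * (v x)\<^sup>2)"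
    using assms L2_product_integrable[OF assms] by (auto simp: L2_def)
  then have "integrable (lebesgue_on \<Omega>) (\<lambda>x. (c * u x + d * v x)\<^sup>2)"
    by (rule back_subst[of "integrable (lebesgue_on \<Omega>)"])
      (auto simp: power2_eq_square algebra_simps)
  then show ?thesis
    using assms by (auto simp: L2_def)
qed

sublocale L2: psd_form "L2 \<Omega>" "L2_inner \<Omega>"
proof
  fix u v w :: "'a \<Rightarrow> real" and c d :: real
  assume "u \<in> L2 \<Omega>" "v \<in> L2 \<Omega>" "w \<in> L2 \<Omega>"
  then show "L2_inner \<Omega> (\<lambda>x. c * u x + d * v x) w = c * L2_inner \<Omega> u w + d * L2_inner \<Omega> v w"
    using L2_product_integrable by (simp add: L2_inner_def distrib_right mult.assoc)
next
  show "(\<lambda>_. 0) \<in> L2 \<Omega>"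
    by (simp add: L2_def)
qed (auto simp: L2_lin L2_inner_def mult.commute)

lemma fe_sub_L2: "V \<subseteq> L2 \<Omega>"
proof
  fix v
  assume v: "v \<in> V"
  have "compact (v ` closure \<Omega>)"
    using bounded_\<Omega> by (intro compact_continuous_image fe_continuous[OF v]) auto
  then obtain b where "\<forall>y\<in>v ` closure \<Omega>. \<bar>y\<bar> \<le> b"
    unfolding bounded_real[symmetric] by (blast dest: compact_imp_bounded bounded_real[THEN iffD1])
  then have b: "\<bar>v x\<bar> \<le> b" if "x \<in> \<Omega>" for x
    using that closure_subset by blast
  have meas: "v \<in> borel_measurable (lebesgue_on \<Omega>)"
    by (rule continuous_imp_measurable_on_sets_lebesgue[OF fe_continuous[OF v] \<Omega>_sets])
  have "integrable (lebesgue_on \<Omega>) (\<lambda>x. (v x)\<^sup>2)"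
  proof (rule integrable_const_bound)
    have "norm ((v x)\<^sup>2) \<le> b\<^sup>2" if "x \<in> \<Omega>" for x
      using b[OF that] abs_le_square_iff[of "v x" b] by simp
    then show "AE x in lebesgue_on \<Omega>. norm ((v x)\<^sup>2) \<le> b\<^sup>2"
      by (intro AE_I2) simp
  qed (use meas in measurable)
  with meas show "v \<in> L2 \<Omega>"
    by (simp add: L2_def)
qed

text \<open>A continuous function that is zero almost everywhere on the open set \<Omega> vanishes
  on its closure. That closure contains the mesh, and off the mesh the function is zero by
  definition.\<close>

sublocale mass: pd_form V "L2_inner \<Omega>"
proof -
  have "psd_form V (L2_inner \<Omega>)"
    by (rule L2.subspace_psd_form[OF fe_sub_L2 fe_zero fe_lin])
  moreover have "v = (\<lambda>_. 0)" if v: "v \<in> V" and zero: "L2_inner \<Omega> v v = 0" for v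
  proof -
    have "integrable (lebesgue_on \<Omega>) (\<lambda>x. v x * v x)"
      using v fe_sub_L2 L2_product_integrable by blast
    then have "AE x in lebesgue_on \<Omega>. v x * v x = 0"
      using zero by (subst integral_nonneg_eq_0_iff_AE[symmetric]) (auto simp: L2_inner_def)
    then have "AE x\<in>\<Omega> in lebesgue. x \<in> {x. v x = 0}"
      using \<Omega>_sets by (simp add: AE_restrict_space_iff)
    moreover have closed: "closed {x. v x = 0}"
      using fe_continuous[OF v] by (intro closed_Collect_eq) auto
    ultimately have "\<Omega> \<subseteq> {x. v x = 0}"
      using open_\<Omega> mem_closed_if_AE_lebesgue_open by blast
    then have "closure \<Omega> \<subseteq> {x. v x = 0}"
      using closed by (rule closure_minimal)
    then have "v x = 0" for x
      using \<T>_sub v by (cases "x \<in> \<Union>\<T>") (auto simp: fe_space_def)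
    then show ?thesis
      by blast
  qed
  ultimately show "pd_form V (L2_inner \<Omega>)"
    by (simp add: pd_form_def pd_form_axioms_def)
qed

lemma one_L2: "(\<lambda>_. 1) \<in> L2 \<Omega>"
  by (simp add: L2_def)

lemma total_eq: "total \<Omega> v = L2_inner \<Omega> v (\<lambda>_. 1)"
  by (simp add: total_def L2_inner_def)

lemma total_linear: "linear_form_on V (total \<Omega>)"
  unfolding linear_form_on_def total_eq using fe_sub_L2 L2.lin one_L2 by blast

text \<open>Cauchy-Schwarz against the constant 1; the factor becomes the \<open>k\<close> of
  \<open>nonlocal_problem\<close>.\<close>

lemma total_bound:
  assumes "v \<in> V"
  shows "\<bar>total \<Omega> v\<bar> \<le> sqrt (measure lebesgue \<Omega>) * sqrt (L2_inner \<Omega> v v)"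
proof -
  have "L2_inner \<Omega> (\<lambda>_. 1 :: real) (\<lambda>_. 1) = measure lebesgue \<Omega>"
    using \<Omega>_sets by (simp add: L2_inner_def measure_restrict_space)
  then show ?thesis
    using L2.Cauchy_Schwarz[of v "\<lambda>_. 1"] assms fe_sub_L2 one_L2
    by (auto simp: total_eq mult.commute)
qed

lemma L2_norm_sq: "u \<in> L2 \<Omega> \<Longrightarrow> (L2_norm \<Omega> u)\<^sup>2 = L2_inner \<Omega> u u"
  using L2.nonneg by (simp add: L2_norm_def)

lemma L2_norm_grad_sq: "u \<in> V \<Longrightarrow> (L2_norm \<Omega> (grad u))\<^sup>2 = L2_inner \<Omega> (grad u) (grad u)"
  using stiffness.nonneg by (simp add: L2_norm_def)

end

section \<open>The fully discrete scheme\<close>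

lemma fe_setting_if_fe_mesh:
  assumes "smooth_bounded_domain \<Omega>" "fe_mesh \<Omega> \<T>"
  shows "fe_setting \<Omega> \<T>"
proof
  show "open \<Omega>" "bounded \<Omega>"
    using assms(1) by (auto simp: smooth_bounded_domain_def)
  show "finite \<T>" "\<Union>\<T> \<subseteq> closure \<Omega>"
    using assms(2) by (auto simp: fe_mesh_def triangulation_def)
  show "\<exists>C. finite C \<and> K = convex hull C" if "K \<in> \<T>" for K
    using assms(2) that by (auto simp: fe_mesh_def simplex)
qed

locale fe_scheme = fe_setting \<Omega> \<T> + graded_mesh \<alpha> T r N
  for \<Omega> :: "'a::euclidean_space set" and \<T> and \<alpha> T r :: real and N :: nat +
  fixes a :: "real \<Rightarrow> real" and f :: "real \<Rightarrow> 'a \<Rightarrow> real" and m1 L :: real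
  assumes m1: "0 < m1" and a_ge: "\<And>x. m1 \<le> a x"
    and a_lip: "\<And>x y. \<bar>a x - a y\<bar> \<le> L * \<bar>x - y\<bar>"
    and f_L2: "\<And>j. 1 \<le> j \<Longrightarrow> j \<le> N \<Longrightarrow> f (ts j) \<in> L2 \<Omega>"
begin

abbreviation "mass_form \<equiv> L2_inner \<Omega>"
abbreviation "stiff u v \<equiv> L2_inner \<Omega> (grad u) (grad v)"
abbreviation "D \<equiv> L21sigma \<alpha> T r N"
abbreviation "avg \<equiv> sigma_avg \<alpha>"
abbreviation "F \<equiv> source_max \<alpha> T r N \<Omega> f"
abbreviation "\<gamma> \<equiv> T powr (- \<alpha>) / G"
abbreviation "scheme \<equiv> scheme_at \<alpha> T r N \<Omega> \<T> a f"

lemma D_eq: "D U n = (\<lambda>x. \<Sum>j=1..n. g n j * (U j x - U (j - 1) x))"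
  by (rule ext) (simp add: L21sigma_def)

lemma avg_eq: "avg U n = (\<lambda>x. (1 - \<sigma>) * U n x + \<sigma> * U (n - 1) x)"
  by (rule ext) (simp add: sigma_avg_def)

lemma D_mem: "(\<And>j. j \<le> n \<Longrightarrow> U j \<in> V) \<Longrightarrow> D U n \<in> V"
  unfolding D_eq by (intro mass.sum_mem mass.diff_mem) auto

lemma avg_mem: "(\<And>j. j \<le> n \<Longrightarrow> U j \<in> V) \<Longrightarrow> avg U n \<in> V"
  unfolding avg_eq by (intro fe_lin) auto

lemma source_sq_le:
  assumes "1 \<le> n" "n \<le> N"
  shows "mass_form (f (ts n)) (f (ts n)) \<le> F\<^sup>2"
proof -
  have "L2_norm \<Omega> (f (ts n)) \<le> F"
    unfolding source_max_def using assms by (intro Max_ge) auto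
  moreover have "0 \<le> L2_norm \<Omega> (f (ts n))"
    using L2.nonneg[OF f_L2[OF assms]] by (simp add: L2_norm_def)
  ultimately show ?thesis
    using L2_norm_sq[OF f_L2[OF assms]] power_mono by metis
qed

text \<open>Testing the scheme with \<open>D U n\<close> itself bounds \<open>stiff (avg U n) (D U n)\<close> by the source
  alone, so no discrete Laplacian is needed.\<close>

lemma energy_increments:
  assumes n: "1 \<le> n" "n \<le> N" and U: "\<And>j. j \<le> n \<Longrightarrow> U j \<in> V" and scheme: "scheme U n"
  shows "(\<Sum>j=1..n. g n j * (stiff (U j) (U j) - stiff (U (j - 1)) (U (j - 1)))) \<le> F\<^sup>2 / (2 * m1)"
proof -
  let ?S = "stiff (avg U n) (D U n)" and ?f = "f (ts n)" and ?a = "a (total \<Omega> (avg U n))"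
  have DV: "D U n \<in> V" and DL: "D U n \<in> L2 \<Omega>"
    using D_mem[OF U] fe_sub_L2 by auto
  have "mass_form (D U n) (D U n) + ?a * ?S = mass_form ?f (D U n)"
    using scheme DV by (simp add: scheme_at_def)
  \<comment> \<open>These weights in Young's inequality make the last term cancel against the same
    term of the tested scheme.\<close>
  moreover have "mass_form ?f (D U n) \<le> mass_form ?f ?f / 4 + mass_form (D U n) (D U n)"
    using L2.young[OF f_L2[OF n] DL, of "1 / 2" 1] by (simp add: power2_eq_square)
  ultimately have aS: "?a * ?S \<le> F\<^sup>2 / 4"
    using source_sq_le[OF n] by linarith
  \<comment> \<open>The coefficient is replaced by its lower bound, which is legitimate when
    \<open>?S\<close> is nonnegative; otherwise the claim is trivial.\<close>
  have "m1 * ?S \<le> F\<^sup>2 / 4"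
  proof (cases "0 \<le> ?S")
    case True
    then show ?thesis
      using mult_right_mono[OF a_ge True, of "total \<Omega> (avg U n)"] aS by linarith
  next
    case False
    then have "m1 * ?S \<le> 0"
      using m1 by (simp add: mult_le_0_iff)
    then show ?thesis
      using zero_le_power2[of F] by linarith
  qed
  then have "2 * ?S \<le> F\<^sup>2 / (2 * m1)"
    using m1 by (simp add: pos_le_divide_eq mult_ac)
  moreover have "(\<Sum>j=1..n. g n j * (stiff (U j) (U j) - stiff (U (j - 1)) (U (j - 1)))) \<le> 2 * ?S"
    unfolding D_eq avg_eq
  proof (rule stiffness.increments_inner_ge[OF n(1) U])
    show "0 \<le> g n 1"
      using gcoef_pos[of 1 n] n by simp
  qed (use gcoef_mono gcoef_diag_dominates \<sigma>_bounds in auto)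
  ultimately show ?thesis
    by linarith
qed

lemma energy_bound:
  assumes n: "n \<le> N" and U: "\<And>j. j \<le> n \<Longrightarrow> U j \<in> V"
    and scheme: "\<And>j. 1 \<le> j \<Longrightarrow> j \<le> n \<Longrightarrow> scheme U j" and "j \<le> n"
  shows "stiff (U j) (U j) \<le> stiff (U 0) (U 0) + F\<^sup>2 / (2 * m1) / \<gamma>"
proof (rule discrete_fractional_comparison[where g = g and m = n])
  fix i
  assume i: "1 \<le> i" "i \<le> n"
  show "\<gamma> \<le> g i 1"
    using gcoef_first_ge i n by simp
  show "(\<Sum>k=1..i. g i k * (stiff (U k) (U k) - stiff (U (k - 1)) (U (k - 1)))) \<le> F\<^sup>2 / (2 * m1)"
    using i n U scheme by (intro energy_increments) auto
qed (use gcoef_mono T G_pos m1 assms(4) in auto)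

text \<open>The average is a convex combination of two levels, and the quadratic form is convex.
  Level \<open>n\<close> is included, so the bound covers any candidate for the new level.\<close>

lemma avg_energy_bound:
  assumes n: "1 \<le> n" "n \<le> N" and U: "\<And>j. j \<le> n \<Longrightarrow> U j \<in> V"
    and scheme: "\<And>j. 1 \<le> j \<Longrightarrow> j \<le> n \<Longrightarrow> scheme U j"
  shows "stiff (avg U n) (avg U n) \<le> stiff (U 0) (U 0) + F\<^sup>2 / (2 * m1) / \<gamma>" (is "_ \<le> ?Y")
proof -
  have V: "U n \<in> V" "U (n - 1) \<in> V"
    using U by auto
  have le: "stiff (U n) (U n) \<le> ?Y" "stiff (U (n - 1)) (U (n - 1)) \<le> ?Y"
    using energy_bound[OF n(2) U scheme] by auto
  have "stiff (avg U n) (avg U n) = (1 - \<sigma>)\<^sup>2 * stiff (U n) (U n) +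
      2 * (1 - \<sigma>) * \<sigma> * stiff (U n) (U (n - 1)) + \<sigma>\<^sup>2 * stiff (U (n - 1)) (U (n - 1))"
    unfolding avg_eq by (rule stiffness.expand[OF V])
  also have "2 * (1 - \<sigma>) * \<sigma> * stiff (U n) (U (n - 1)) \<le>
      (1 - \<sigma>) * \<sigma> * (stiff (U n) (U n) + stiff (U (n - 1)) (U (n - 1)))"
  proof -
    have "2 * stiff (U n) (U (n - 1)) \<le> stiff (U n) (U n) + stiff (U (n - 1)) (U (n - 1))"
      using stiffness.young[OF V, of 1 1] by simp
    moreover have "0 \<le> (1 - \<sigma>) * \<sigma>"
      using \<sigma>_bounds by simp
    ultimately have "(1 - \<sigma>) * \<sigma> * (2 * stiff (U n) (U (n - 1))) \<le>
        (1 - \<sigma>) * \<sigma> * (stiff (U n) (U n) + stiff (U (n - 1)) (U (n - 1)))"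
      by (rule mult_left_mono)
    then show ?thesis
      by (simp only: mult_ac)
  qed
  finally have "stiff (avg U n) (avg U n) \<le>
      (1 - \<sigma>) * stiff (U n) (U n) + \<sigma> * stiff (U (n - 1)) (U (n - 1))"
    by (simp add: power2_eq_square algebra_simps)
  also have "\<dots> \<le> ?Y"
    using le \<sigma>_bounds by (intro convex_bound_le) auto
  finally show ?thesis .
qed

text \<open>The part of \<open>D U n\<close> known before step \<open>n\<close>: in terms of the
  average W, the last increment is \<open>(W - U (n - 1)) / (1 - \<sigma>)\<close>, and its second
  half belongs to the data.\<close>

definition history :: "(nat \<Rightarrow> 'a \<Rightarrow> real) \<Rightarrow> nat \<Rightarrow> 'a \<Rightarrow> real" where
  "history U n = (\<lambda>x. - (g n n / (1 - \<sigma>)) * U (n - 1) x +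
     1 * (\<Sum>j=1..n - 1. g n j * (U j x - U (j - 1) x)))"

lemma history_mem: "1 \<le> n \<Longrightarrow> (\<And>j. j < n \<Longrightarrow> U j \<in> V) \<Longrightarrow> history U n \<in> V"
  unfolding history_def by (intro fe_lin mass.sum_mem mass.diff_mem) auto

lemma D_split:
  assumes "1 \<le> n"
  shows "D (U(n := w)) n = (\<lambda>x. g n n / (1 - \<sigma>) * avg (U(n := w)) n x + 1 * history U n x)"
proof
  fix x
  obtain m where n: "n = Suc m"
    using assms by (cases n) auto
  have eq: "(\<Sum>j=1..m. g n j * ((U(n := w)) j x - (U(n := w)) (j - 1) x)) =
      (\<Sum>j=1..m. g n j * (U j x - U (j - 1) x))"
    by (intro sum.cong) (auto simp: n)
  have "g n n / (1 - \<sigma>) * ((1 - \<sigma>) * w x + \<sigma> * U m x) - g n n / (1 - \<sigma>) * U m x =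
      g n n / (1 - \<sigma>) * (1 - \<sigma>) * (w x - U m x)"
    by (simp only: right_diff_distrib distrib_left left_diff_distrib mult.assoc mult_1)
  also have "\<dots> = g n n * (w x - U m x)"
    using \<sigma>_bounds by simp
  finally show "D (U(n := w)) n x = g n n / (1 - \<sigma>) * avg (U(n := w)) n x + 1 * history U n x"
    using eq unfolding D_eq avg_eq history_def n by simp
qed

lemma scheme_iff:
  assumes n: "1 \<le> n" "n \<le> N" and U: "\<And>j. j < n \<Longrightarrow> U j \<in> V" and w: "w \<in> V"
  defines "W \<equiv> avg (U(n := w)) n"
  shows "scheme (U(n := w)) n \<longleftrightarrow>
    (\<forall>v\<in>V. g n n / (1 - \<sigma>) * mass_form W v + a (total \<Omega> W) * stiff W v =
      mass_form (f (ts n)) v - mass_form (history U n) v)"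
proof -
  have W: "W \<in> V"
    unfolding W_def using U w by (intro avg_mem) auto
  have H: "history U n \<in> V"
    using history_mem[OF n(1) U] .
  have "mass_form (D (U(n := w)) n) v = g n n / (1 - \<sigma>) * mass_form W v + mass_form (history U n) v"
    if "v \<in> V" for v
    unfolding D_split[OF n(1)] W_def[symmetric] using mass.lin[OF W H that, of "g n n / (1 - \<sigma>)" 1]
    by (simp only: mult_1)
  then show ?thesis
    unfolding scheme_at_def W_def[symmetric] by (auto simp: algebra_simps)
qed

theorem unique_step:
  assumes n: "1 \<le> n" "n \<le> N" and U: "\<And>j. j < n \<Longrightarrow> U j \<in> V"
    and scheme: "\<And>j. 1 \<le> j \<Longrightarrow> j < n \<Longrightarrow> scheme U j"
    and small: "L\<^sup>2 * measure lebesgue \<Omega> * (stiff (U 0) (U 0) + F\<^sup>2 / (2 * m1) / \<gamma>) <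
      4 * m1 * (g n n / (1 - \<sigma>))"
  shows "\<exists>!w. w \<in> V \<and> scheme (U(n := w)) n"
proof -
  obtain P where P: "finite P" "\<And>v. v \<in> V \<Longrightarrow> (\<And>p. p \<in> P \<Longrightarrow> v p = 0) \<Longrightarrow> v = (\<lambda>_. 0)"
    using fe_determined_by_vertices by metis
  let ?c = "g n n / (1 - \<sigma>)" and ?k = "sqrt (measure lebesgue \<Omega>)"
  let ?R = "\<lambda>v. mass_form (f (ts n)) v - mass_form (history U n) v"
  have \<sigma>1: "0 < 1 - \<sigma>"
    using \<sigma>_bounds by simp
  \<comment> \<open>With truncated subtraction this fails for \<open>n = 0\<close>; it ensures that
    updating \<open>U\<close> at \<open>n\<close> leaves level \<open>n - 1\<close> alone.\<close>
  have n1: "n - 1 \<noteq> n"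
    using n(1) by linarith
  have c: "0 < ?c"
    using gcoef_pos[of n n] n \<sigma>1 by simp
  interpret nonlocal_problem V mass_form stiff P a "total \<Omega>" m1 L ?k ?c
    by unfold_locales (use P m1 a_ge a_lip total_linear total_bound c in auto)
  have "linear_form_on V ?R"
  proof -
    have H: "history U n \<in> V"
      using history_mem[OF n(1) U] .
    show ?thesis
      unfolding linear_form_on_def
    proof (intro ballI allI)
      fix u v and b d :: real
      assume uv: "u \<in> V" "v \<in> V"
      then have L2: "u \<in> L2 \<Omega>" "v \<in> L2 \<Omega>"
        using fe_sub_L2 by auto
      then show "?R (\<lambda>x. b * u x + d * v x) = b * ?R u + d * ?R v"
        unfolding mass.lin_right[OF uv H] L2.lin_right[OF L2 f_L2[OF n]]
        by (simp add: algebra_simps)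
    qed
  qed
  from exists_solution[OF this] obtain W where W: "W \<in> V"
    "\<forall>v\<in>V. ?c * mass_form W v + a (total \<Omega> W) * stiff W v = ?R v"
    by blast
  \<comment> \<open>The new level is recovered from \<open>W\<close> by inverting the
    average.\<close>
  define w where "w = (\<lambda>x. 1 / (1 - \<sigma>) * W x + - (\<sigma> / (1 - \<sigma>)) * U (n - 1) x)"
  have w: "w \<in> V"
    unfolding w_def using W(1) U n(1) by (intro fe_lin) auto
  have avg_w: "avg (U(n := w)) n = W"
  proof
    fix x
    have "w x = (W x - \<sigma> * U (n - 1) x) / (1 - \<sigma>)"
      by (simp add: w_def diff_divide_distrib)
    then have "(1 - \<sigma>) * w x = W x - \<sigma> * U (n - 1) x"
      using \<sigma>1 by simp
    then show "avg (U(n := w)) n x = W x"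
      using n1 by (simp add: avg_eq)
  qed
  have "scheme (U(n := w)) n"
    using scheme_iff[where U = U, OF n U w] W(2) unfolding avg_w by blast
  moreover have "u = v" if u: "u \<in> V" "scheme (U(n := u)) n" and v: "v \<in> V" "scheme (U(n := v)) n" for u v
  proof -
    have V: "(U(n := u)) j \<in> V" "(U(n := v)) j \<in> V" if "j \<le> n" for j
      using that U u v by auto
    \<comment> \<open>The energy bound needs the scheme on all levels up to \<open>n\<close>; those
      below \<open>n\<close> do not see the update.\<close>
    have "scheme (U(n := v)) j" if j: "1 \<le> j" "j \<le> n" for j
    proof (cases "j = n")
      case False
      then have "D (U(n := v)) j = D U j" "avg (U(n := v)) j = avg U j"
        using j by (auto simp: D_eq avg_eq intro!: ext sum.cong)
      then show ?thesis
        using scheme[of j] j False by (simp add: scheme_at_def)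
    qed (use v in simp)
    then have "stiff (avg (U(n := v)) n) (avg (U(n := v)) n) \<le>
        stiff (U 0) (U 0) + F\<^sup>2 / (2 * m1) / \<gamma>"
      using avg_energy_bound[where U = "U(n := v)", OF n V(2)] n(1) by simp
    from mult_left_mono[OF this, of "L\<^sup>2 * measure lebesgue \<Omega>"]
    have "(L * ?k)\<^sup>2 * stiff (avg (U(n := v)) n) (avg (U(n := v)) n) < 4 * m1 * ?c"
      using small by (simp add: power_mult_distrib)
    then have "avg (U(n := u)) n = avg (U(n := v)) n"
      by (rule unique_solution[where F = ?R, rotated -1])
        (use scheme_iff[where U = U, OF n U u(1)] scheme_iff[where U = U, OF n U v(1)] u v
          avg_mem[where U = "U(n := u)", OF V(1)] avg_mem[where U = "U(n := v)", OF V(2)] in auto)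
    \<comment> \<open>Both candidates share level \<open>n - 1\<close>, so equal averages force
      equal new levels.\<close>
    then have "(1 - \<sigma>) * u x = (1 - \<sigma>) * v x" for x
      using n1 by (auto simp: avg_eq fun_eq_iff)
    then show ?thesis
      using \<sigma>1 by (simp add: fun_eq_iff)
  qed
  ultimately show ?thesis
    using w by blast
qed

text \<open>Since \<open>acoef\<close> plus \<open>bcoef\<close> is \<open>g n n * \<tau> n\<close>,
  the step size cancels from the restriction, which becomes a lower bound on the diagonal
  weight.\<close>

lemma gcoef_diag_ge_step_bound:
  assumes n: "1 \<le> n" "n \<le> N" and q: "0 < q"
    and step: "\<tau> n \<le> 2 * m1 * (acoef \<alpha> T r N n n + bcoef \<alpha> T r N n (n - 1)) / ((1 - \<sigma>) * q)"
  shows "q \<le> 2 * m1 * (g n n / (1 - \<sigma>))"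
proof -
  have \<tau>: "0 < \<tau> n"
    using \<tau>_pos n by simp
  have \<sigma>1: "0 < 1 - \<sigma>"
    using \<sigma>_bounds by simp
  have "acoef \<alpha> T r N n n + bcoef \<alpha> T r N n (n - 1) = g n n * \<tau> n"
    using \<tau> by (simp add: gcoef_def)
  then have "\<tau> n * ((1 - \<sigma>) * q) \<le> 2 * m1 * (g n n * \<tau> n)"
    using step \<sigma>1 q by (simp add: pos_le_divide_eq)
  then have "\<tau> n * ((1 - \<sigma>) * q) \<le> \<tau> n * (2 * m1 * g n n)"
    by (simp add: mult_ac)
  then show ?thesis
    using \<tau> \<sigma>1 by (simp add: pos_le_divide_eq mult.commute)
qed

end

text \<open>With \<open>s\<close> the initial gradient norm and \<open>e\<close> the contribution of
  the source, this places the energy bound below the square of the constant R1.\<close>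

lemma add_le_square_mult_one_plus:
  fixes s e :: real
  assumes "0 \<le> s" "0 \<le> e"
  shows "s\<^sup>2 + e \<le> ((1 + e) * (1 + s))\<^sup>2"
proof -
  have "s\<^sup>2 + e \<le> (1 + e) * (1 + s\<^sup>2)"
    using assms by (simp add: algebra_simps)
  also have "\<dots> \<le> (1 + e)\<^sup>2 * (1 + s)\<^sup>2"
    using assms by (intro mult_mono) (auto simp: power2_eq_square algebra_simps)
  finally show ?thesis
    by (simp add: power_mult_distrib)
qed

text \<open>The constants are functions of the maximal source norm, chosen before the source, the
  meshes, the level and the iterates; this expresses their uniformity. The update
  \<open>U(n := w)\<close> inserts the candidate for the new level.\<close>

theorem theorem4p2:
  fixes \<Omega> :: "'a::euclidean_space set"
    and \<alpha> T r m1 m2 L :: real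
    and a :: "real \<Rightarrow> real"
  assumes dim: "DIM('a) = 1 \<or> DIM('a) = 2"
    and dom: "smooth_bounded_domain \<Omega>"
    and T: "0 < T" and alpha: "0 < \<alpha>" "\<alpha> < 1" and r: "1 \<le> r"
    and H1: "0 < m1" "0 < m2" "\<And>x. m1 \<le> a x \<and> a x \<le> m2"
    and H2: "0 < L" "\<And>x1 x2. \<bar>a x1 - a x2\<bar> \<le> L * \<bar>x1 - x2\<bar>"
  shows "\<exists>C1 C2 :: real \<Rightarrow> real. (\<forall>F. 0 < C1 F \<and> 0 < C2 F) \<and>
    (\<forall>(f :: real \<Rightarrow> 'a \<Rightarrow> real) (u0 :: 'a \<Rightarrow> real) (N :: nat) (\<kappa> :: real) (\<T> :: 'a set set)
      (U :: nat \<Rightarrow> 'a \<Rightarrow> real) (n :: nat).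
      f \<in> Bochner_L2 T \<Omega> \<and> u0 \<in> Sobolev_H10 \<Omega> \<inter> Sobolev_H 2 \<Omega> \<and>
      (\<forall>j\<in>{1..N}. f (tsigma \<alpha> T r N j) \<in> L2 \<Omega>) \<and>
      0 < \<kappa> \<and> fe_mesh \<Omega> \<T> \<and> quasi_uniform \<kappa> \<T> \<and>
      1 \<le> n \<and> n \<le> N \<and>
      (\<forall>j<n. U j \<in> fe_space \<T>) \<and>
      (\<forall>j\<in>{1..<n}. scheme_at \<alpha> T r N \<Omega> \<T> a f U j) \<longrightarrow>
      (let F = source_max \<alpha> T r N \<Omega> f;
           R1 = C2 F * (1 + L2_norm \<Omega> (grad (U 0)))
       in Max (tstep T r N ` {1..N}) \<le> step_bound \<alpha> T r N n m1 L (C1 F) R1 \<longrightarrow>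
          (\<exists>!w. w \<in> fe_space \<T> \<and> scheme_at \<alpha> T r N \<Omega> \<T> a f (U(n := w)) n)))"
proof -
  define k where "k = sqrt (measure lebesgue \<Omega>)"
  \<comment> \<open>The denominator cancels the factor \<open>1 - 2 * \<sigma>\<close> in the step
    bound; \<open>1 + k\<close> dominates \<open>k\<close> and is positive.\<close>
  define C1 where "C1 = (\<lambda>F :: real. (1 + k) / (1 - \<alpha>))"
  define C2 where "C2 = (\<lambda>F. 1 + F\<^sup>2 / (2 * m1) / (T powr (- \<alpha>) / Gamma (1 - \<alpha>)))"
  have k: "0 \<le> k"
    by (simp add: k_def)
  have Gamma: "0 < Gamma (1 - \<alpha>)"
    using alpha by (intro Gamma_real_pos) simp
  have C2: "0 \<le> F\<^sup>2 / (2 * m1) / (T powr (- \<alpha>) / Gamma (1 - \<alpha>))" for F :: real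
    using Gamma H1(1) by simp
  have pos: "0 < C1 F" "0 < C2 F" for F
    using k alpha(2) C2[of F] by (auto simp: C1_def C2_def add_nonneg_pos)
  have main: "\<exists>!w. w \<in> fe_space \<T> \<and> scheme_at \<alpha> T r N \<Omega> \<T> a f (U(n := w)) n"
    if f: "\<forall>j\<in>{1..N}. f (tsigma \<alpha> T r N j) \<in> L2 \<Omega>"
      and mesh: "fe_mesh \<Omega> \<T>" and n: "1 \<le> n" "n \<le> N"
      and U: "\<forall>j<n. U j \<in> fe_space \<T>"
      and scheme: "\<forall>j\<in>{1..<n}. scheme_at \<alpha> T r N \<Omega> \<T> a f U j"
      and step: "Max (tstep T r N ` {1..N}) \<le> step_bound \<alpha> T r N n m1 L
        (C1 (source_max \<alpha> T r N \<Omega> f))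
        (C2 (source_max \<alpha> T r N \<Omega> f) * (1 + L2_norm \<Omega> (grad (U 0))))"
    for f :: "real \<Rightarrow> 'a \<Rightarrow> real" and N \<T> n and U :: "nat \<Rightarrow> 'a \<Rightarrow> real"
  proof -
    let ?F = "source_max \<alpha> T r N \<Omega> f"
    let ?R1 = "C2 ?F * (1 + L2_norm \<Omega> (grad (U 0)))"
    interpret fe_setting \<Omega> \<T>
      by (rule fe_setting_if_fe_mesh[OF dom mesh])
    interpret fe_scheme \<Omega> \<T> \<alpha> T r N a f m1 L
      by unfold_locales (use assms f n in auto)
    let ?s = "L2_norm \<Omega> (grad (U 0))" and ?e = "?F\<^sup>2 / (2 * m1) / (T powr (- \<alpha>) / Gamma (1 - \<alpha>))"
    define q where "q = (L * C1 ?F * ?R1 * (1 - 2 * sigma \<alpha>))\<^sup>2"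
    have U0: "U 0 \<in> fe_space \<T>"
      using U n by simp
    have s: "0 \<le> ?s" "?s\<^sup>2 = stiff (U 0) (U 0)"
      using L2_norm_grad_sq[OF U0] stiffness.nonneg[OF U0] by (auto simp: L2_norm_def)
    have R1: "0 < ?R1"
      using pos(2) s(1) by (simp add: add_pos_nonneg)
    have "L * C1 ?F * ?R1 * (1 - 2 * sigma \<alpha>) = L * (1 + k) * ?R1"
      using alpha by (simp add: C1_def sigma_def)
    then have q: "q = (L * (1 + k))\<^sup>2 * ?R1\<^sup>2"
      by (simp only: q_def power_mult_distrib)
    have "0 < L * (1 + k)"
      using k H2(1) by simp
    then have "0 < q"
      unfolding q using R1 by (simp only: mult_pos_pos zero_less_power)
    have "tstep T r N n \<le> Max (tstep T r N ` {1..N})"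
      using n by (intro Max_ge) auto
    also note step
    finally have "q \<le> 2 * m1 * (gcoef \<alpha> T r N n n / (1 - sigma \<alpha>))"
      using \<open>0 < q\<close> by (intro gcoef_diag_ge_step_bound n) (auto simp: step_bound_def q_def)
    moreover have "L\<^sup>2 * measure lebesgue \<Omega> * (stiff (U 0) (U 0) + ?e) \<le> q"
    proof -
      have "?s\<^sup>2 + ?e \<le> ((1 + ?e) * (1 + ?s))\<^sup>2"
        by (rule add_le_square_mult_one_plus[OF s(1) C2])
      also have "\<dots> = ?R1\<^sup>2"
        by (simp add: C2_def)
      finally have "stiff (U 0) (U 0) + ?e \<le> ?R1\<^sup>2"
        unfolding s(2) .
      moreover have "L\<^sup>2 * measure lebesgue \<Omega> \<le> (L * (1 + k))\<^sup>2"
      proof -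
        have "L\<^sup>2 * measure lebesgue \<Omega> = (L * k)\<^sup>2"
          by (simp add: k_def power_mult_distrib)
        also have "\<dots> \<le> (L * (1 + k))\<^sup>2"
          using H2(1) k by (intro power_mono mult_left_mono) auto
        finally show ?thesis .
      qed
      ultimately show ?thesis
        unfolding q using stiffness.nonneg[OF U0] C2[of ?F] by (intro mult_mono) auto
    qed
    \<comment> \<open>The step restriction gives \<open>q\<close> at most half of the threshold
      \<open>4 * m1 * c\<close> with \<open>c = g n n / (1 - \<sigma>)\<close>; positivity of
      \<open>m1 * c\<close> makes the required inequality strict.\<close>
    moreover have "0 < m1 * (gcoef \<alpha> T r N n n / (1 - sigma \<alpha>))"
      using H1(1) gcoef_pos[of n n] n \<sigma>_bounds by simp
    ultimately have "L\<^sup>2 * measure lebesgue \<Omega> * (stiff (U 0) (U 0) + ?e) <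
        4 * m1 * (gcoef \<alpha> T r N n n / (1 - sigma \<alpha>))"
      unfolding mult.assoc[of _ m1] by argo
    then show ?thesis
      using U scheme by (intro unique_step n) auto
  qed
  show ?thesis
    unfolding Let_def
  proof (rule exI[of _ C1], rule exI[of _ C2], rule conjI)
    show "\<forall>F. 0 < C1 F \<and> 0 < C2 F"
      using pos by blast
  qed (intro allI impI, rule main, blast+)
qed

end
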